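(* Let $\widetilde D\subset\mathbb{R}^2$ be any ellipse of semi-axes of length $a$ and $b$, and let $\lambda=\lambda'+i\lambda''$ ($\lambda',\lambda''\in\mathbb{R}$, $\lambda''\neq0$) be such that $|\lambda''|\ll1$ and $|\lambda'|<1/2$. Then $$\big|\Im(\mathrm{Tr}(M(\lambda,\widetilde D)))\big|\le\frac{4\lambda'^2|\widetilde D|}{|\lambda''|(\lambda''^2+4\lambda'^2)}+\frac{2|\lambda''||\widetilde D|}{\lambda''^2+4\lambda'^2}+O\Big(\frac{\lambda''^2}{4\lambda'^2+\lambda''^2}\Big).$$
   Context: For a domain $D\subset\mathbb{R}^2$ with outward unit normal $\nu=(\nu_1,\nu_2)$, $\mathcal{K}_D^*[\psi](x)=\frac1{2\pi}\int_{\partial D}\frac{(x-y)\cdot\nu(x)}{|x-y|^2}\psi(y)d\sigma(y)$, $x\in\partial D$, and the polarization tensor is the $2\times2$ matrix with entries $M_{l,m}(\lambda,D)=\int_{\partial D}x_l(\lambda Id-\mathcal{K}_D^* )^{-1}[\nu_m](x)\,d\sigma(x)$. $|\widetilde D|$ is the area. The $O$-term is understood as $\lambda''\to0$. *)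

theory Defs
  imports "HOL-Analysis.Analysis" "HOL-Library.Landau_Symbols"
begin

text \<open>
  Arc-length measure of the curve \<open>\<gamma>\<close>, as a Borel measure on the plane concentrated on
  \<open>path_image \<gamma>\<close>: for a piecewise \<open>C\<^sup>1\<close> path, the integral of \<open>f\<close> with respect to it is
  \<open>\<integral>\<^sub>0\<^sup>1 f (\<gamma> t) |\<gamma>' t| dt\<close>.
\<close>

definition arclength_measure :: "(real \<Rightarrow> real^2) \<Rightarrow> (real^2) measure" where
  "arclength_measure \<gamma> =
     distr (density (restrict_space lborel {0..1})
              (\<lambda>t. ennreal (norm (vector_derivative \<gamma> (at t within {0..1})))))
       borel \<gamma>"

text \<open>
  The unit vector \<open>n\<close> such that every direction pointing strictly against \<open>n\<close> enters \<open>D\<close> at \<open>x\<close>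
  and every direction pointing strictly along \<open>n\<close> leaves it. Such an \<open>n\<close> is unique, and it exists
  at every boundary point of a domain with \<open>C\<^sup>1\<close> boundary.
\<close>

definition outward_unit_normal :: "(real^2) set \<Rightarrow> real^2 \<Rightarrow> real^2" where
  "outward_unit_normal D x =
     (THE n. norm n = 1 \<and>
        (\<forall>v. v \<bullet> n < 0 \<longrightarrow> (\<forall>\<^sub>F t in at_right 0. x + t *\<^sub>R v \<in> D)) \<and>
        (\<forall>v. v \<bullet> n > 0 \<longrightarrow> (\<forall>\<^sub>F t in at_right 0. x + t *\<^sub>R v \<notin> D)))"

text \<open>
  Below, \<open>\<gamma>\<close> is a simple closed path parametrizing the boundary of \<open>D\<close>.
  \<open>NP_adjoint\<close> is the Neumann--Poincare operator \<open>K\<^sub>D\<^sup>*\<close>. At \<open>y = x\<close> the kernel is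
  \<open>0\<close> by the convention \<open>z / 0 = 0\<close>; a single point has arc-length measure zero.
\<close>

definition NP_adjoint ::
  "(real^2) set \<Rightarrow> (real \<Rightarrow> real^2) \<Rightarrow> (real^2 \<Rightarrow> complex) \<Rightarrow> real^2 \<Rightarrow> complex" where
  "NP_adjoint D \<gamma> \<psi> x =
     complex_of_real (1 / (2 * pi)) *
     (\<integral>y. complex_of_real (((x - y) \<bullet> outward_unit_normal D x) / (norm (x - y))\<^sup>2) * \<psi> y
        \<partial>arclength_measure \<gamma>)"

definition square_integrable :: "'a measure \<Rightarrow> ('a \<Rightarrow> complex) \<Rightarrow> bool" where
  "square_integrable M \<psi> \<longleftrightarrow>
     \<psi> \<in> borel_measurable M \<and> integrable M (\<lambda>x. (cmod (\<psi> x))\<^sup>2)"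

text \<open>
  A representative of \<open>(lam Id - K\<^sub>D\<^sup>*)\<^sup>-\<^sup>1[f]\<close>, the operator acting on \<open>L\<^sup>2(\<partial>D)\<close>. Elements of \<open>L\<^sup>2\<close> are
  represented by functions, so when \<open>lam Id - K\<^sub>D\<^sup>*\<close> is invertible (for instance when \<open>lam\<close> is not
  real and the boundary is smooth) the chosen function is determined up to a null set.
\<close>

definition NP_resolvent ::
  "complex \<Rightarrow> (real^2) set \<Rightarrow> (real \<Rightarrow> real^2) \<Rightarrow> (real^2 \<Rightarrow> complex) \<Rightarrow> real^2 \<Rightarrow> complex" where
  "NP_resolvent lam D \<gamma> f =
     (SOME \<phi>. square_integrable (arclength_measure \<gamma>) \<phi> \<and>
        (AE x in arclength_measure \<gamma>. lam * \<phi> x - NP_adjoint D \<gamma> \<phi> x = f x))"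

definition polarization_tensor ::
  "complex \<Rightarrow> (real^2) set \<Rightarrow> (real \<Rightarrow> real^2) \<Rightarrow> complex^2^2" where
  "polarization_tensor lam D \<gamma> =
     (\<chi> l m. \<integral>x. complex_of_real (x $ l) *
          NP_resolvent lam D \<gamma> (\<lambda>y. complex_of_real (outward_unit_normal D y $ m)) x
        \<partial>arclength_measure \<gamma>)"

text \<open>
  The open ellipse with centre \<open>c\<close>, semi-axes of length \<open>a\<close>, \<open>b\<close>, the axis of length \<open>a\<close> making
  the angle \<open>\<theta>\<close> with the first coordinate axis, and the standard parametrization of its boundary.
\<close>

definition axis1 :: "real \<Rightarrow> real^2" where
  "axis1 \<theta> = vector [cos \<theta>, sin \<theta>]"

definition axis2 :: "real \<Rightarrow> real^2" where
  "axis2 \<theta> = vector [- sin \<theta>, cos \<theta>]"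

definition ellipse :: "real^2 \<Rightarrow> real \<Rightarrow> real \<Rightarrow> real \<Rightarrow> (real^2) set" where
  "ellipse c \<theta> a b =
     {c + s *\<^sub>R axis1 \<theta> + t *\<^sub>R axis2 \<theta> | s t. (s / a)\<^sup>2 + (t / b)\<^sup>2 < 1}"

definition ellipse_path :: "real^2 \<Rightarrow> real \<Rightarrow> real \<Rightarrow> real \<Rightarrow> real \<Rightarrow> real^2" where
  "ellipse_path c \<theta> a b t =
     c + (a * cos (2 * pi * t)) *\<^sub>R axis1 \<theta> + (b * sin (2 * pi * t)) *\<^sub>R axis2 \<theta>"

lemma axis_combination_eq_iff:
  "s *\<^sub>R axis1 \<theta> + t *\<^sub>R axis2 \<theta> = s' *\<^sub>R axis1 \<theta> + t' *\<^sub>R axis2 \<theta> \<longleftrightarrow> s = s' \<and> t = t'"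
proof
  assume eq: "s *\<^sub>R axis1 \<theta> + t *\<^sub>R axis2 \<theta> = s' *\<^sub>R axis1 \<theta> + t' *\<^sub>R axis2 \<theta>"
  have o: "axis1 \<theta> \<bullet> axis1 \<theta> = 1" "axis2 \<theta> \<bullet> axis2 \<theta> = 1" "axis1 \<theta> \<bullet> axis2 \<theta> = 0"
    "axis2 \<theta> \<bullet> axis1 \<theta> = 0"
    by (simp_all add: axis1_def axis2_def inner_vec_def sum_2 flip: power2_eq_square)
  have "s = s'" using arg_cong[OF eq, of "\<lambda>x. x \<bullet> axis1 \<theta>"] by (simp add: inner_add_left o)
  moreover have "t = t'" using arg_cong[OF eq, of "\<lambda>x. x \<bullet> axis2 \<theta>"] by (simp add: inner_add_left o)
  ultimately show "s = s' \<and> t = t'" by simp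
qed auto

lemma simple_path_ellipse_path:
  assumes "a > 0" "b > 0"
  shows "simple_path (ellipse_path c \<theta> a b)"
    and "pathfinish (ellipse_path c \<theta> a b) = pathstart (ellipse_path c \<theta> a b)"
proof -
  show "pathfinish (ellipse_path c \<theta> a b) = pathstart (ellipse_path c \<theta> a b)"
    by (simp add: pathfinish_def pathstart_def ellipse_path_def)
  have "path (ellipse_path c \<theta> a b)"
    unfolding path_def ellipse_path_def by (intro continuous_intros)
  moreover have "loop_free (ellipse_path c \<theta> a b)"
    unfolding loop_free_def
  proof (intro ballI impI)
    fix x y :: real
    assume xy: "x \<in> {0..1}" "y \<in> {0..1}"
      and "ellipse_path c \<theta> a b x = ellipse_path c \<theta> a b y"
    then have "cos (2 * pi * x) = cos (2 * pi * y)" "sin (2 * pi * x) = sin (2 * pi * y)"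
      using assms by (auto simp: ellipse_path_def add.assoc axis_combination_eq_iff)
    then obtain n :: int where "2 * pi * x = 2 * pi * y + 2 * pi * n"
      using sin_cos_eq_iff by metis
    then have "2 * pi * (x - y - n) = 0" by (simp add: algebra_simps)
    then have n: "x - y = n" by simp
    then have "\<bar>real_of_int n\<bar> \<le> 1" using xy by auto
    then have "n = 0 \<or> n = 1 \<or> n = -1" by linarith
    then show "x = y \<or> x = 0 \<and> y = 1 \<or> x = 1 \<and> y = 0" using n xy by auto
  qed
  ultimately show "simple_path (ellipse_path c \<theta> a b)" by (simp add: simple_path_def)
qed

lemma path_image_ellipse_path:
  assumes "a > 0" "b > 0"
  shows "path_image (ellipse_path c \<theta> a b) = frontier (ellipse c \<theta> a b)"
proof -
  define F :: "real^2 \<Rightarrow> real^2" where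
    "F = (\<lambda>x. (a * x $ 1) *\<^sub>R axis1 \<theta> + (b * x $ 2) *\<^sub>R axis2 \<theta>)"
  have lin: "linear F" unfolding F_def by (intro linearI) (simp_all add: algebra_simps)
  have inj: "inj F"
  proof (rule injI)
    fix x y assume "F x = F y"
    then have "a * x $ 1 = a * y $ 1" "b * x $ 2 = b * y $ 2"
      unfolding F_def axis_combination_eq_iff by auto
    then show "x = y" using assms by (simp add: vec_eq_iff forall_2)
  qed
  have nrm: "norm x = sqrt ((x $ 1)\<^sup>2 + (x $ 2)\<^sup>2)" for x :: "real^2"
    by (simp add: norm_vec_def L2_set_def sum_2)
  have ell: "ellipse c \<theta> a b = (+) c ` F ` ball 0 1"
  proof (intro equalityI subsetI)
    fix x assume "x \<in> ellipse c \<theta> a b"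
    then obtain s t where "x = c + F (vector [s / a, t / b])" "(s / a)\<^sup>2 + (t / b)\<^sup>2 < 1"
      using assms by (auto simp: ellipse_def F_def add.assoc)
    then show "x \<in> (+) c ` F ` ball 0 1" by (auto simp: nrm intro!: imageI)
  next
    fix x assume "x \<in> (+) c ` F ` ball 0 1"
    then obtain y where "x = c + F y" "(y $ 1)\<^sup>2 + (y $ 2)\<^sup>2 < 1" by (auto simp: nrm)
    then have "x = c + (a * y $ 1) *\<^sub>R axis1 \<theta> + (b * y $ 2) *\<^sub>R axis2 \<theta>"
      "(a * y $ 1 / a)\<^sup>2 + (b * y $ 2 / b)\<^sup>2 < 1"
      using assms by (simp_all add: F_def)
    then show "x \<in> ellipse c \<theta> a b" unfolding ellipse_def by blast
  qed
  have "frontier (ellipse c \<theta> a b) = (+) c ` F ` sphere 0 1"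
  proof -
    have "frontier (F ` ball 0 1) = F ` closure (ball 0 1) - F ` interior (ball 0 1)"
      using lin inj
      by (simp add: frontier_def closure_injective_linear_image interior_injective_linear_image
          del: closure_ball)
    also have "\<dots> = F ` frontier (ball 0 1)"
      unfolding frontier_def using inj by (rule image_set_diff[symmetric])
    finally show ?thesis unfolding ell frontier_translation by simp
  qed
  also have "\<dots> = path_image (ellipse_path c \<theta> a b)"
  proof (intro equalityI subsetI)
    fix x assume "x \<in> (+) c ` F ` sphere 0 1"
    then obtain y where y: "x = c + F y" "(y $ 1)\<^sup>2 + (y $ 2)\<^sup>2 = 1" by (auto simp: nrm)
    then obtain t where t: "0 \<le> t" "t < 2 * pi" "y $ 1 = cos t" "y $ 2 = sin t"
      using sincos_total_2pi by metis
    then have "x = ellipse_path c \<theta> a b (t / (2 * pi))"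
      by (simp add: y F_def ellipse_path_def add.assoc)
    then show "x \<in> path_image (ellipse_path c \<theta> a b)"
      using t by (auto simp: path_image_def intro!: imageI)
  next
    fix x assume "x \<in> path_image (ellipse_path c \<theta> a b)"
    then obtain t where "x = c + F (vector [cos (2 * pi * t), sin (2 * pi * t)])"
      by (auto simp: path_image_def F_def ellipse_path_def add.assoc)
    then show "x \<in> (+) c ` F ` sphere 0 1" by (auto simp: nrm intro!: imageI)
  qed
  finally show ?thesis ..
qed

end

theory Submission
  imports Defs
begin

text \<open>
  In the parametrization \<open>t \<mapsto> (a cos 2\<pi>t, b sin 2\<pi>t)\<close>, and after multiplying densities by the speed, the
  Neumann--Poincare operator of an ellipse becomes the integral operator with kernel \<open>P (t + s)\<close>,
  where \<open>P\<close> is the Poisson kernel with parameter \<open>e = (a - b) / (a + b)\<close>. Hence \<open>1\<close>, \<open>cos\<close> and \<open>sin\<close> are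
  eigenfunctions with eigenvalues \<open>1/2\<close>, \<open>e/2\<close> and \<open>- e/2\<close>. The kernel is symmetric, so testing the resolvent
  equation against these three functions determines every moment that enters the polarization
  tensor, without any uniqueness statement for the resolvent. This gives
  \<open>Tr M = |D| (1 / (\<lambda> - e/2) + 1 / (\<lambda> + e/2))\<close>, and it remains to bound the sum of the two imaginary
  parts uniformly in \<open>e\<close>: the claimed main terms are its value at \<open>|e/2| = |\<lambda>'|\<close>, and moving \<open>e\<close> away from
  this resonance gains at most \<open>O(\<lambda>''\<^sup>2)\<close>.
\<close>

subsection \<open>Integrals against the Poisson kernel\<close>

abbreviation unit_lborel :: "real measure" where
  "unit_lborel \<equiv> restrict_space lborel {0..1}"

lemma measurable_unit_lborel: "f \<in> borel_measurable borel \<Longrightarrow> f \<in> borel_measurable unit_lborel"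
  by (intro measurable_restrict_space1) simp

lemma integrable_unit_lborel:
  fixes f :: "real \<Rightarrow> 'a::{banach, second_countable_topology}"
  assumes "continuous_on {0..1} f"
  shows "integrable unit_lborel f"
  using borel_integrable_atLeastAtMost'[OF assms]
  by (simp add: integrable_restrict_space set_integrable_def)

lemma integral_unit_lborel_FTC:
  fixes f :: "real \<Rightarrow> 'a::euclidean_space"
  assumes "continuous_on {0..1} f"
    and "\<And>t. (F has_vector_derivative f t) (at t)"
  shows "integral\<^sup>L unit_lborel f = F 1 - F 0"
  using integral_FTC_atLeastAtMost[of 0 1 F f] assms
  by (simp add: integral_restrict_space has_vector_derivative_at_within)

lemma measure_unit_lborel [simp]: "measure unit_lborel {0..1} = 1"
  by (simp add: measure_restrict_space)

lemma finite_measure_unit_lborel: "finite_measure unit_lborel"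
  by (rule finite_measureI) (simp add: emeasure_restrict_space space_restrict_space)

definition circ :: "real \<Rightarrow> complex" where
  "circ t = cis (2 * pi * t)"

lemma circ_add: "circ (s + t) = circ s * circ t"
  by (simp add: circ_def cis_mult distrib_left)

lemma norm_circ [simp]: "norm (circ t) = 1"
  by (simp add: circ_def)

lemma circ_nz [simp]: "circ t \<noteq> 0"
  by (simp add: circ_def)

lemma cnj_circ_mult [simp]: "cnj (circ t) * circ t = 1" "circ t * cnj (circ t) = 1"
  by (simp_all add: circ_def cis_cnj cis_mult)

lemma circ_0_1 [simp]: "circ 0 = 1" "circ 1 = 1"
  by (simp_all add: circ_def complex_eq_iff)

lemma circ_deriv: "(circ has_vector_derivative 2 * pi * \<i> * circ t) (at t)"
proof -
  have "circ = (\<lambda>t. exp (2 * pi * \<i> * of_real t))"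
    by (simp add: circ_def cis_conv_exp fun_eq_iff mult_ac)
  moreover have "((\<lambda>t. exp (2 * pi * \<i> * of_real t)) has_vector_derivative 2 * pi * \<i> * exp (2 * pi * \<i> * of_real t)) (at t)"
    by (rule has_vector_derivative_real_field) (auto intro!: derivative_eq_intros)
  ultimately show ?thesis by metis
qed

lemma continuous_circ [continuous_intros]:
  "continuous_on A f \<Longrightarrow> continuous_on A (\<lambda>t. circ (f t))"
  unfolding circ_def by (intro continuous_intros)

lemma integral_circ: "integral\<^sup>L unit_lborel circ = 0"
proof -
  have "integral\<^sup>L unit_lborel (\<lambda>t. 2 * pi * \<i> * circ t) = circ 1 - circ 0"
    by (rule integral_unit_lborel_FTC) (intro continuous_intros circ_deriv)+
  then show ?thesis by simp
qed

text \<open>Closed form of the sum of \<open>(e * circ t) ^ n\<close> over n >= 1, for |e| < 1: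
  twice the positive-frequency part of \<open>poisson\<close>. The closed form avoids interchanging
  a series with an integral.\<close>

definition geom :: "real \<Rightarrow> real \<Rightarrow> complex" where
  "geom e t = e * circ t / (1 - e * circ t)"

text \<open>Positivity of the real part, stronger than being nonzero, keeps the denominator where
  the principal branch \<open>Ln\<close> is holomorphic.\<close>

lemma geom_denominator_Re: "\<bar>e\<bar> < 1 \<Longrightarrow> 0 < Re (1 - of_real e * circ t)"
proof -
  assume "\<bar>e\<bar> < 1"
  have "\<bar>Re (of_real e * circ t)\<bar> \<le> cmod (of_real e * circ t)" by (rule abs_Re_le_cmod)
  also have "\<dots> < 1" using \<open>\<bar>e\<bar> < 1\<close> by (simp add: norm_mult)
  finally show ?thesis by simp
qed

lemma geom_denominator_nz: "\<bar>e\<bar> < 1 \<Longrightarrow> 1 - of_real e * circ t \<noteq> 0"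
  using geom_denominator_Re[of e t] by (metis less_irrefl zero_complex.sel(1))

lemma continuous_geom [continuous_intros]:
  "\<bar>e\<bar> < 1 \<Longrightarrow> continuous_on A f \<Longrightarrow> continuous_on A (\<lambda>t. geom e (f t))"
  unfolding geom_def by (intro continuous_intros ballI geom_denominator_nz)

text \<open>The function \<open>Ln (1 - e * circ (t + s))\<close> is 1-periodic in \<open>t\<close>,
  and its derivative is \<open>geom\<close> up to a nonzero constant, so the integral over a period
  vanishes.\<close>

lemma integral_geom:
  assumes "\<bar>e\<bar> < 1"
  shows "integral\<^sup>L unit_lborel (\<lambda>t. geom e (t + s)) = 0"
proof -
  have "((\<lambda>t. Ln (1 - e * circ (t + s))) has_vector_derivative (- 2 * pi * \<i> * geom e (t + s))) (at t)" for t
  proof -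
    have "((\<lambda>t. circ (t + s)) has_vector_derivative 2 * pi * \<i> * circ (t + s)) (at t)"
      using vector_diff_chain_at[of "\<lambda>t. t + s" 1 t circ, OF _ circ_deriv]
      by (simp add: o_def has_vector_derivative_add_const)
    then have "((\<lambda>t. 1 - e * circ (t + s)) has_vector_derivative - (e * (2 * pi * \<i> * circ (t + s)))) (at t)"
      by (auto intro!: derivative_eq_intros)
    moreover have "(Ln has_field_derivative inverse (1 - e * circ (t + s))) (at (1 - e * circ (t + s)))"
      using geom_denominator_Re[OF assms, of "t + s"]
      by (intro has_field_derivative_Ln) (auto simp: complex_nonpos_Reals_iff)
    ultimately have "(Ln \<circ> (\<lambda>t. 1 - e * circ (t + s)) has_vector_derivative
       - (e * (2 * pi * \<i> * circ (t + s))) * inverse (1 - e * circ (t + s))) (at t)"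
      by (rule field_vector_diff_chain_at)
    then show ?thesis by (simp add: o_def geom_def field_simps)
  qed
  then have "integral\<^sup>L unit_lborel (\<lambda>t. - 2 * pi * \<i> * geom e (t + s))
      = Ln (1 - e * circ (1 + s)) - Ln (1 - e * circ (0 + s))"
    by (intro integral_unit_lborel_FTC) (auto intro!: continuous_intros assms)
  then show ?thesis by (simp add: circ_add)
qed

text \<open>Half of the classical Poisson kernel, in a variable of period 1. The half is chosen so
  that, with \<open>e = ratio\<close>, this is exactly the kernel of the transformed
  Neumann-Poincare operator. Negative \<open>e\<close> is allowed.\<close>

definition poisson :: "real \<Rightarrow> real \<Rightarrow> real" where
  "poisson e t = (1 - e\<^sup>2) / (2 * (1 - 2 * e * cos (2 * pi * t) + e\<^sup>2))"

lemma poisson_denominator_ge: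
  fixes e u :: real
  shows "(1 - \<bar>e\<bar>)\<^sup>2 \<le> 1 - 2 * e * cos u + e\<^sup>2"
proof -
  have "\<bar>e * cos u\<bar> \<le> \<bar>e\<bar> * 1" using abs_cos_le_one[of u] unfolding abs_mult by (intro mult_left_mono) auto
  then show ?thesis by (simp add: power2_eq_square algebra_simps)
qed

lemma poisson_denominator:
  fixes e u :: real
  assumes "\<bar>e\<bar> < 1"
  shows "0 < 1 - 2 * e * cos u + e\<^sup>2"
  by (rule less_le_trans[OF _ poisson_denominator_ge]) (use assms in simp)

lemma norm_poisson_le:
  assumes "\<bar>e\<bar> < 1"
  shows "cmod (of_real (poisson e t)) \<le> 1 / (2 * (1 - \<bar>e\<bar>)\<^sup>2)"
proof -
  have "\<bar>1 - e\<^sup>2\<bar> \<le> 1" using assms by (simp add: abs_square_le_1)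
  then show ?thesis
    using poisson_denominator_ge[of e "2 * pi * t"] poisson_denominator[OF assms, of "2 * pi * t"] assms
    unfolding poisson_def norm_of_real abs_divide by (intro frac_le) auto
qed

text \<open>With z = \<open>e * circ t\<close>, the classical kernel is the real part of (1 + z) /
  (1 - z) = 1 + 2 z / (1 - z). This splits it into its constant, positive-frequency and
  negative-frequency parts.\<close>

lemma poisson_geom:
  assumes "\<bar>e\<bar> < 1"
  shows "of_real (poisson e t) = (1 + geom e t + cnj (geom e t)) / 2"
proof -
  define x where "x = e * cos (2 * pi * t)"
  define y where "y = e * sin (2 * pi * t)"
  have xy: "of_real e * circ t = Complex x y"
    by (simp add: circ_def x_def y_def complex_eq_iff)
  have e: "x\<^sup>2 + y\<^sup>2 = e\<^sup>2" unfolding x_def y_def power_mult_distrib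
    by (simp flip: distrib_left)
  have d: "(1 - x)\<^sup>2 + y\<^sup>2 = 1 - 2 * x + e\<^sup>2" using e by (simp add: power2_eq_square algebra_simps)
  have dp: "1 - 2 * x + e\<^sup>2 > 0" using poisson_denominator[OF assms, of "2 * pi * t"] by (simp add: x_def)
  have "1 + geom e t + cnj (geom e t) = of_real (1 + 2 * Re (geom e t))"
    by (simp add: complex_eq_iff)
  moreover have "Re (geom e t) = (x * (1 - x) - y * y) / ((1 - x)\<^sup>2 + y\<^sup>2)"
    unfolding geom_def xy by (simp add: Re_divide)
  moreover have "1 + 2 * ((x * (1 - x) - y * y) / ((1 - x)\<^sup>2 + y\<^sup>2)) = (1 - e\<^sup>2) / (1 - 2 * x + e\<^sup>2)"
    unfolding d using dp e by (simp add: divide_simps) (simp add: power2_eq_square algebra_simps)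
  ultimately have "1 + geom e t + cnj (geom e t) = of_real ((1 - e\<^sup>2) / (1 - 2 * x + e\<^sup>2))"
    by metis
  moreover have "poisson e t = (1 - e\<^sup>2) / (1 - 2 * x + e\<^sup>2) / 2"
    by (simp add: poisson_def x_def mult.assoc)
  ultimately show ?thesis by simp
qed

lemma continuous_poisson [continuous_intros]:
  fixes f :: "'a::t2_space \<Rightarrow> real"
  shows "\<bar>e\<bar> < 1 \<Longrightarrow> continuous_on A f \<Longrightarrow> continuous_on A (\<lambda>t. poisson e (f t))"
proof -
  assume e: "\<bar>e\<bar> < 1" and f: "continuous_on A f"
  have "2 * (1 - 2 * e * cos (2 * pi * f t) + e\<^sup>2) \<noteq> 0" for t
    using poisson_denominator[OF e, of "2 * pi * f t"] by simp
  then show ?thesis unfolding poisson_def using f by (intro continuous_intros ballI) auto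
qed

text \<open>Only the constant Fourier mode survives integration; this is the eigenvalue 1/2 of the
  constants.\<close>

lemma integral_poisson:
  assumes "\<bar>e\<bar> < 1"
  shows "integral\<^sup>L unit_lborel (\<lambda>t. of_real (poisson e (t + s)) :: complex) = 1 / 2"
proof -
  have "integrable unit_lborel (\<lambda>t. geom e (t + s))"
    by (intro integrable_unit_lborel continuous_intros assms)
  then show ?thesis unfolding poisson_geom[OF assms]
    by (simp add: integral_geom[OF assms] finite_measure.integrable_const[OF finite_measure_unit_lborel])
qed

text \<open>Multiplication by \<open>circ t\<close> raises every frequency by one, so only the mode
  of frequency -1 contributes. The conjugate on the right comes from the kernel depending on
  \<open>t + s\<close> instead of \<open>t - s\<close>; it is what gives cosine and sine eigenvalues
  of opposite sign.\<close>

lemma integral_poisson_circ: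
  assumes "\<bar>e\<bar> < 1"
  shows "integral\<^sup>L unit_lborel (\<lambda>t. of_real (poisson e (t + s)) * circ t) = e / 2 * cnj (circ s)"
proof -
  define w where "w = e * circ s"
  \<comment> \<open>This is z * z / (1 - z) = z / (1 - z) - z with z = \<open>w * circ t\<close>,
    divided by \<open>w\<close>. For \<open>e = 0\<close> both sides are 0, the right one by the
    convention on division by zero.\<close>
  have G: "geom e (t + s) * circ t = (geom e (t + s) - w * circ t) / w" for t
  proof (cases "e = 0")
    case False
    then show ?thesis unfolding geom_def w_def
      using geom_denominator_nz[OF assms, of "t + s"]
      by (simp add: field_simps circ_add)
  qed (simp add: geom_def w_def)
  have C: "cnj (geom e (t + s)) * circ t = cnj w * (1 + cnj (geom e (t + s)))" for t
  proof -
    \<comment> \<open>The recursion z / (1 - z) = z (1 + z / (1 - z)). Multiplying by the conjugate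
      of \<open>circ t\<close> cancels that factor of z, and conjugation then gives the
      claim.\<close>
    have "geom e (t + s) = w * circ t * (1 + geom e (t + s))"
      unfolding geom_def w_def using geom_denominator_nz[OF assms, of "t + s"]
      by (simp add: field_simps circ_add)
    then have "geom e (t + s) * cnj (circ t) = w * (circ t * cnj (circ t)) * (1 + geom e (t + s))"
      by (metis mult.assoc mult.commute)
    then show ?thesis by (metis cnj_circ_mult(2) complex_cnj_add complex_cnj_cnj complex_cnj_mult complex_cnj_one mult.right_neutral)
  qed
  have eq: "of_real (poisson e (t + s)) * circ t
    = (circ t + (geom e (t + s) - w * circ t) / w + cnj w * (1 + cnj (geom e (t + s)))) / 2" for t
    unfolding poisson_geom[OF assms] G[symmetric] C[symmetric] by (simp add: field_simps)
  have i: "integrable unit_lborel (\<lambda>t. geom e (t + s))" "integrable unit_lborel circ"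
      "integrable unit_lborel (\<lambda>t. 1::complex)"
    by (intro integrable_unit_lborel continuous_intros assms)+
  show ?thesis unfolding eq using i
    by (simp add: integral_geom[OF assms] integral_circ w_def)
qed

lemma circ_cos_sin:
  "of_real (cos (2 * pi * t)) = (circ t + cnj (circ t)) / 2"
  "of_real (sin (2 * pi * t)) = (circ t - cnj (circ t)) / (2 * \<i>)"
  by (simp_all add: circ_def complex_eq_iff Re_divide Im_divide)

text \<open>Since \<open>poisson\<close> is real, both integrals are combinations of the integral
  against \<open>circ\<close> and its conjugate. Conjugating \<open>circ s\<close> preserves the
  cosine and changes the sign of the sine.\<close>

lemma integral_poisson_cos_sin:
  assumes "\<bar>e\<bar> < 1"
  shows "integral\<^sup>L unit_lborel (\<lambda>t. of_real (poisson e (t + s)) * of_real (cos (2 * pi * t)))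
      = complex_of_real (e / 2 * cos (2 * pi * s))" (is ?A)
    and "integral\<^sup>L unit_lborel (\<lambda>t. of_real (poisson e (t + s)) * of_real (sin (2 * pi * t)))
      = complex_of_real (- e / 2 * sin (2 * pi * s))" (is ?B)
proof -
  let ?f = "\<lambda>t. of_real (poisson e (t + s)) * circ t"
  have i: "integrable unit_lborel ?f"
    by (intro integrable_unit_lborel continuous_intros assms)
  have j: "integral\<^sup>L unit_lborel (\<lambda>t. cnj (?f t)) = e / 2 * circ s"
    by (subst Bochner_Integration.integral_cnj) (simp only: integral_poisson_circ[OF assms], simp)
  have i': "integrable unit_lborel (\<lambda>t. cnj (?f t))"
    by (intro integrable_unit_lborel continuous_intros assms)
  have "integral\<^sup>L unit_lborel (\<lambda>t. (?f t + cnj (?f t)) / 2) = (e / 2 * cnj (circ s) + e / 2 * circ s) / 2"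
    unfolding integral_divide_zero Bochner_Integration.integral_add[OF i i'] Bochner_Integration.integral_diff[OF i i']
      integral_poisson_circ[OF assms] j by simp
  moreover have "of_real (poisson e (t + s)) * of_real (cos (2 * pi * t)) = (?f t + cnj (?f t)) / 2" for t
    unfolding circ_cos_sin by (simp add: field_simps)
  ultimately show ?A unfolding of_real_mult circ_cos_sin by (simp add: field_simps)
  have "integral\<^sup>L unit_lborel (\<lambda>t. (?f t - cnj (?f t)) / (2 * \<i>)) = (e / 2 * cnj (circ s) - e / 2 * circ s) / (2 * \<i>)"
    unfolding integral_divide_zero Bochner_Integration.integral_add[OF i i'] Bochner_Integration.integral_diff[OF i i']
      integral_poisson_circ[OF assms] j by simp
  moreover have "of_real (poisson e (t + s)) * of_real (sin (2 * pi * t)) = (?f t - cnj (?f t)) / (2 * \<i>)" for t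
    unfolding circ_cos_sin by (simp add: field_simps)
  ultimately show ?B unfolding of_real_mult circ_cos_sin by (simp add: field_simps)
qed

text \<open>Multiplying the equation by \<open>E\<close>, integrating and exchanging the integrals
  moves the operator from \<Phi> onto \<open>E\<close>, where it acts as the scalar \<kappa>. The
  premise \<open>eig\<close> integrates over the first argument of \<open>k\<close> and
  \<open>eq\<close> over the second, so \<open>E\<close> is an eigenfunction of the transposed
  kernel; for a kernel in \<open>t + s\<close> the two coincide.\<close>

lemma symmetric_kernel_tested:
  fixes k :: "real \<Rightarrow> real \<Rightarrow> complex" and E F \<Phi> :: "real \<Rightarrow> complex"
  assumes M: "finite_measure M"
    and k: "(\<lambda>(t, s). k t s) \<in> borel_measurable (M \<Otimes>\<^sub>M M)" and kB: "\<And>t s. cmod (k t s) \<le> B"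
    and E: "E \<in> borel_measurable M" and EB: "\<And>t. cmod (E t) \<le> B'"
    and eig: "\<And>s. (\<integral>t. k t s * E t \<partial>M) = \<kappa> * E s"
    and \<Phi>: "integrable M \<Phi>"
    and eq: "AE t in M. \<mu> * \<Phi> t - (\<integral>s. k t s * \<Phi> s \<partial>M) = F t"
    and FE: "integrable M (\<lambda>t. F t * E t)"
  shows "(\<mu> - \<kappa>) * (\<integral>t. \<Phi> t * E t \<partial>M) = (\<integral>t. F t * E t \<partial>M)"
proof -
  interpret finite_measure M by fact
  interpret P: pair_sigma_finite M M ..
  note [measurable] = k E
  have [measurable]: "\<Phi> \<in> borel_measurable M" using \<Phi> by auto
  have \<Phi>E: "integrable M (\<lambda>t. \<Phi> t * E t)"
    by (rule Bochner_Integration.integrable_bound[where f = "\<lambda>t. of_real B' * \<Phi> t"])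
      (use \<Phi> EB in \<open>auto simp: norm_mult mult.commute[of "cmod (\<Phi> _)"]
          intro!: AE_I2 mult_right_mono order_trans[OF _ abs_ge_self]\<close>)
  \<comment> \<open>Dominating function for Fubini: \<open>k\<close> and \<open>E\<close> are
    bounded, and \<Phi> as a function of the second variable is integrable on the product because
    \<open>M\<close> is finite.\<close>
  have "integrable (M \<Otimes>\<^sub>M M) (\<lambda>(t, s). \<Phi> s)"
    by (rule P.Fubini_integrable) (use \<Phi> in auto)
  then have "integrable (M \<Otimes>\<^sub>M M) (\<lambda>(t, s). (of_real B * of_real B') * \<Phi> s)"
    unfolding case_prod_unfold by (intro integrable_mult_right)
  then have int: "integrable (M \<Otimes>\<^sub>M M) (\<lambda>(t, s). k t s * E t * \<Phi> s)"
  proof (rule Bochner_Integration.integrable_bound)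
    show "AE x in M \<Otimes>\<^sub>M M. norm (case x of (t, s) \<Rightarrow> k t s * E t * \<Phi> s)
        \<le> norm (case x of (t, s) \<Rightarrow> of_real B * of_real B' * \<Phi> s)"
    proof (rule AE_I2, clarsimp simp: norm_mult)
      fix t s
      have "cmod (k t s) * cmod (E t) \<le> B * B'"
        using kB[of t s] EB[of t] by (intro mult_mono) (auto intro: order_trans[OF norm_ge_zero])
      also have "\<dots> \<le> \<bar>B\<bar> * \<bar>B'\<bar>" by (simp flip: abs_mult)
      finally show "cmod (k t s) * cmod (E t) * cmod (\<Phi> s) \<le> \<bar>B\<bar> * \<bar>B'\<bar> * cmod (\<Phi> s)"
        by (intro mult_right_mono) auto
    qed
  qed measurable
  have "(\<integral>t. (\<integral>s. k t s * \<Phi> s \<partial>M) * E t \<partial>M) = (\<integral>t. (\<integral>s. k t s * E t * \<Phi> s \<partial>M) \<partial>M)"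
  proof (rule Bochner_Integration.integral_cong[OF refl])
    fix t
    have "(\<integral>s. k t s * E t * \<Phi> s \<partial>M) = (\<integral>s. E t * (k t s * \<Phi> s) \<partial>M)" by (simp add: mult_ac)
    then show "(\<integral>s. k t s * \<Phi> s \<partial>M) * E t = (\<integral>s. k t s * E t * \<Phi> s \<partial>M)" by simp
  qed
  also have "\<dots> = (\<integral>s. (\<integral>t. k t s * E t * \<Phi> s \<partial>M) \<partial>M)"
    using P.Fubini_integral[OF int] by simp
  also have "\<dots> = (\<integral>s. \<kappa> * (\<Phi> s * E s) \<partial>M)"
  proof (rule Bochner_Integration.integral_cong[OF refl])
    fix s
    show "(\<integral>t. k t s * E t * \<Phi> s \<partial>M) = \<kappa> * (\<Phi> s * E s)"
      by (subst integral_mult_left_zero) (simp add: eig)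
  qed
  finally have swap: "(\<integral>t. (\<integral>s. k t s * \<Phi> s \<partial>M) * E t \<partial>M) = \<kappa> * (\<integral>s. \<Phi> s * E s \<partial>M)" by simp
  have "(\<integral>t. F t * E t \<partial>M) + (\<integral>t. (\<integral>s. k t s * \<Phi> s \<partial>M) * E t \<partial>M) = (\<integral>t. \<mu> * (\<Phi> t * E t) \<partial>M)"
  proof -
    \<comment> \<open>Solved for the operator term, the equation expresses its integral through two
      functions already known to be integrable.\<close>
    have AE: "AE t in M. \<mu> * (\<Phi> t * E t) - F t * E t = (\<integral>s. k t s * \<Phi> s \<partial>M) * E t"
      using eq
    proof eventually_elim
      case (elim t)
      show ?case unfolding elim[symmetric] by (simp add: algebra_simps)
    qed
    have "(\<integral>t. (\<integral>s. k t s * \<Phi> s \<partial>M) * E t \<partial>M) = (\<integral>t. \<mu> * (\<Phi> t * E t) - F t * E t \<partial>M)"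
      by (rule integral_cong_AE) (use AE FE in \<open>auto elim: eventually_mono\<close>)
    then show ?thesis using FE \<Phi>E by simp
  qed
  then show ?thesis using swap by (simp add: algebra_simps)
qed

subsection \<open>Geometry of the ellipse\<close>

lemma integral_unit_lborel_trig:
  "integral\<^sup>L unit_lborel (\<lambda>t. cos (2 * pi * t)) = 0"
  "integral\<^sup>L unit_lborel (\<lambda>t. sin (2 * pi * t)) = 0"
  "integral\<^sup>L unit_lborel (\<lambda>t. (cos (2 * pi * t))\<^sup>2) = 1 / 2"
  "integral\<^sup>L unit_lborel (\<lambda>t. (sin (2 * pi * t))\<^sup>2) = 1 / 2"
  "integral\<^sup>L unit_lborel (\<lambda>t. sin (2 * pi * t) * cos (2 * pi * t)) = 0"
proof -
  note FTC = integral_unit_lborel_FTC[OF _ has_real_derivative_iff_has_vector_derivative[THEN iffD1]]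
  have "integral\<^sup>L unit_lborel (\<lambda>t. cos (2 * pi * t)) = sin (2 * pi * 1) / (2 * pi) - sin (2 * pi * 0) / (2 * pi)"
    by (rule FTC) (auto intro!: continuous_intros derivative_eq_intros)
  then show "integral\<^sup>L unit_lborel (\<lambda>t. cos (2 * pi * t)) = 0" by simp
  have "integral\<^sup>L unit_lborel (\<lambda>t. sin (2 * pi * t)) = - cos (2 * pi * 1) / (2 * pi) - - cos (2 * pi * 0) / (2 * pi)"
    by (rule FTC) (auto intro!: continuous_intros derivative_eq_intros)
  then show "integral\<^sup>L unit_lborel (\<lambda>t. sin (2 * pi * t)) = 0" by simp
  have c: "1 / 2 + ((cos x)\<^sup>2 - (sin x)\<^sup>2) / 2 = (cos x)\<^sup>2" "1 / 2 - ((cos x)\<^sup>2 - (sin x)\<^sup>2) / 2 = (sin x)\<^sup>2" for x :: real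
    using sin_cos_squared_add[of x] by (auto simp: field_simps)
  have "integral\<^sup>L unit_lborel (\<lambda>t. 1 / 2 + ((cos (2 * pi * t))\<^sup>2 - (sin (2 * pi * t))\<^sup>2) / 2)
     = (1 / 2 + sin (2 * pi * 1) * cos (2 * pi * 1) / (4 * pi)) - (0 / 2 + sin (2 * pi * 0) * cos (2 * pi * 0) / (4 * pi))"
    by (rule FTC) (auto intro!: continuous_intros derivative_eq_intros simp: field_simps power2_eq_square)
  then show "integral\<^sup>L unit_lborel (\<lambda>t. (cos (2 * pi * t))\<^sup>2) = 1 / 2" unfolding c by simp
  have "integral\<^sup>L unit_lborel (\<lambda>t. 1 / 2 - ((cos (2 * pi * t))\<^sup>2 - (sin (2 * pi * t))\<^sup>2) / 2)
     = (1 / 2 - sin (2 * pi * 1) * cos (2 * pi * 1) / (4 * pi)) - (0 / 2 - sin (2 * pi * 0) * cos (2 * pi * 0) / (4 * pi))"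
    by (rule FTC) (auto intro!: continuous_intros derivative_eq_intros simp: field_simps power2_eq_square)
  then show "integral\<^sup>L unit_lborel (\<lambda>t. (sin (2 * pi * t))\<^sup>2) = 1 / 2" unfolding c by simp
  have "integral\<^sup>L unit_lborel (\<lambda>t. sin (2 * pi * t) * cos (2 * pi * t))
     = (sin (2 * pi * 1))\<^sup>2 / (4 * pi) - (sin (2 * pi * 0))\<^sup>2 / (4 * pi)"
    by (rule FTC) (auto intro!: continuous_intros derivative_eq_intros simp: field_simps power2_eq_square)
  then show "integral\<^sup>L unit_lborel (\<lambda>t. sin (2 * pi * t) * cos (2 * pi * t)) = 0" by simp
qed

lemma axis_inner [simp]:
  "axis1 \<theta> \<bullet> axis1 \<theta> = 1" "axis2 \<theta> \<bullet> axis2 \<theta> = 1" "axis1 \<theta> \<bullet> axis2 \<theta> = 0" "axis2 \<theta> \<bullet> axis1 \<theta> = 0"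
  by (simp_all add: axis1_def axis2_def inner_vec_def sum_2 flip: power2_eq_square)

lemma axis_decomposition: "(x \<bullet> axis1 \<theta>) *\<^sub>R axis1 \<theta> + (x \<bullet> axis2 \<theta>) *\<^sub>R axis2 \<theta> = x"
proof -
  have e: "(u * cos \<theta> + v * sin \<theta>) * cos \<theta> + (v * cos \<theta> - u * sin \<theta>) * (- sin \<theta>) = u"
    "(u * cos \<theta> + v * sin \<theta>) * sin \<theta> + (v * cos \<theta> - u * sin \<theta>) * cos \<theta> = v" for u v
    using sin_cos_squared_add[of \<theta>] by algebra+
  show ?thesis
    using e[of "x $ 1" "x $ 2"] by (simp add: vec_eq_iff forall_2 axis1_def axis2_def inner_vec_def sum_2)
qed

lemma norm_axis_combination: "(norm (s *\<^sub>R axis1 \<theta> + t *\<^sub>R axis2 \<theta>))\<^sup>2 = s\<^sup>2 + t\<^sup>2"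
  unfolding power2_norm_eq_inner by (simp add: inner_add_left inner_add_right power2_eq_square)

section \<open>Speed, area and outward normal of the ellipse\<close>

locale elliptic_boundary =
  fixes c :: "real^2" and \<theta> a b :: real
  assumes a: "a > 0" and b: "b > 0"
begin

abbreviation "\<gamma> \<equiv> ellipse_path c \<theta> a b"
abbreviation "D \<equiv> ellipse c \<theta> a b"

text \<open>The speed with respect to the angle \<open>2 * pi * t\<close>; with respect to
  \<open>t\<close> there is a further factor \<open>2 * pi\<close>.\<close>

definition speed :: "real \<Rightarrow> real" where
  "speed t = sqrt ((a * sin (2 * pi * t))\<^sup>2 + (b * cos (2 * pi * t))\<^sup>2)"

text \<open>Negative when \<open>a < b\<close>, since the semi-axes are not ordered. For
  \<open>a > b\<close> it is exp (- 2 rho), where rho is the value of the elliptic radial coordinate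
  on the boundary.\<close>

definition ratio :: real where "ratio = (a - b) / (a + b)"

lemma abs_ratio: "\<bar>ratio\<bar> < 1"
  using a b by (simp add: ratio_def abs_if divide_simps)

lemma speed_pos: "speed t > 0"
proof -
  have "sin (2 * pi * t) \<noteq> 0 \<or> cos (2 * pi * t) \<noteq> 0" using sin_cos_squared_add[of "2 * pi * t"] by force
  then have "(a * sin (2 * pi * t))\<^sup>2 + (b * cos (2 * pi * t))\<^sup>2 > 0"
    unfolding sum_power2_gt_zero_iff using a b by simp
  then show ?thesis unfolding speed_def by (rule real_sqrt_gt_zero)
qed

lemma continuous_speed [continuous_intros]:
  fixes f :: "'a::t2_space \<Rightarrow> real"
  shows "continuous_on A f \<Longrightarrow> continuous_on A (\<lambda>t. speed (f t))"
  unfolding speed_def by (intro continuous_intros)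

lemma continuous_path [continuous_intros]: "continuous_on A \<gamma>"
  unfolding ellipse_path_def by (intro continuous_intros)

lemma path_inner:
  "(\<gamma> t - c) \<bullet> axis1 \<theta> = a * cos (2 * pi * t)" "(\<gamma> t - c) \<bullet> axis2 \<theta> = b * sin (2 * pi * t)"
  by (simp_all add: ellipse_path_def inner_add_left)

lemma mem_ellipse: "x \<in> D \<longleftrightarrow> ((x - c) \<bullet> axis1 \<theta> / a)\<^sup>2 + ((x - c) \<bullet> axis2 \<theta> / b)\<^sup>2 < 1"
proof
  assume "x \<in> D"
  then show "((x - c) \<bullet> axis1 \<theta> / a)\<^sup>2 + ((x - c) \<bullet> axis2 \<theta> / b)\<^sup>2 < 1"
    by (auto simp: ellipse_def inner_add_left)
next
  assume "((x - c) \<bullet> axis1 \<theta> / a)\<^sup>2 + ((x - c) \<bullet> axis2 \<theta> / b)\<^sup>2 < 1"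
  moreover have "x = c + ((x - c) \<bullet> axis1 \<theta>) *\<^sub>R axis1 \<theta> + ((x - c) \<bullet> axis2 \<theta>) *\<^sub>R axis2 \<theta>"
    using axis_decomposition[of "x - c" \<theta>] by (simp add: add.assoc)
  ultimately show "x \<in> D" unfolding ellipse_def by blast
qed

text \<open>The ellipse is a translate of the image of the unit disc under a linear map of
  determinant \<open>a * b\<close>.\<close>

lemma measure_ellipse: "measure lebesgue D = pi * a * b"
proof -
  define F :: "real^2 \<Rightarrow> real^2" where
    "F = (\<lambda>x. (a * x $ 1) *\<^sub>R axis1 \<theta> + (b * x $ 2) *\<^sub>R axis2 \<theta>)"
  have lin: "linear F" unfolding F_def by (intro linearI) (simp_all add: algebra_simps)
  have nrm: "norm x = sqrt ((x $ 1)\<^sup>2 + (x $ 2)\<^sup>2)" for x :: "real^2"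
    by (simp add: norm_vec_def L2_set_def sum_2)
  have ell: "D = (+) c ` F ` ball 0 1"
  proof (intro equalityI subsetI)
    fix x assume "x \<in> D"
    then obtain s t where "x = c + F (vector [s / a, t / b])" "(s / a)\<^sup>2 + (t / b)\<^sup>2 < 1"
      using a b by (auto simp: ellipse_def F_def add.assoc)
    then show "x \<in> (+) c ` F ` ball 0 1" by (auto simp: nrm intro!: imageI)
  next
    fix x assume "x \<in> (+) c ` F ` ball 0 1"
    then show "x \<in> D" using a b by (auto simp: mem_ellipse nrm F_def inner_add_left)
  qed
have "det (matrix F) = a * cos \<theta> * (b * cos \<theta>) + b * sin \<theta> * (a * sin \<theta>)"
    unfolding det_2 by (simp add: matrix_def F_def axis1_def axis2_def axis_def)
  also have "\<dots> = a * b * ((cos \<theta>)\<^sup>2 + (sin \<theta>)\<^sup>2)"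
    unfolding power2_eq_square by (simp only: ring_distribs mult_ac)
  finally have det: "det (matrix F) = a * b" by simp
  have "measure lebesgue D = measure lebesgue (F ` ball 0 1)"
    unfolding ell by (rule measure_translation)
  also have "\<dots> = \<bar>det (matrix F)\<bar> * measure lebesgue (ball 0 1 :: (real^2) set)"
    by (rule measure_linear_image[OF lin]) simp
  also have "measure lebesgue (ball 0 1 :: (real^2) set) = pi"
    by (simp add: content_ball unit_ball_vol_2)
  finally show ?thesis using a b by (simp add: det)
qed

text \<open>The candidate is the normalized gradient of the quadratic form defining the ellipse.
  Along a ray from the boundary point that form is a quadratic polynomial, whose linear coefficient
  has the sign of the inner product with the candidate and decides membership for small positive
  parameters.\<close>

lemma outward_unit_normal_ellipse:
  "outward_unit_normal D (\<gamma> t) =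
     (b * cos (2 * pi * t) / speed t) *\<^sub>R axis1 \<theta> + (a * sin (2 * pi * t) / speed t) *\<^sub>R axis2 \<theta>"
    (is "_ = ?n")
  unfolding outward_unit_normal_def
proof (rule the_equality)
  define p where "p = cos (2 * pi * t)"
  define q where "q = sin (2 * pi * t)"
  have pq: "p\<^sup>2 + q\<^sup>2 = 1" by (simp add: p_def q_def)
  have "(norm ?n)\<^sup>2 = ((b * p)\<^sup>2 + (a * q)\<^sup>2) / (speed t)\<^sup>2"
    unfolding norm_axis_combination p_def q_def by (simp add: power_divide add_divide_distrib)
  also have "(b * p)\<^sup>2 + (a * q)\<^sup>2 = (speed t)\<^sup>2"
    by (simp add: speed_def p_def q_def add.commute)
  finally have "(norm ?n)\<^sup>2 = 1" using speed_pos[of t] by simp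
  then have n1: "norm ?n = 1" by (metis real_sqrt_abs abs_norm_cancel real_sqrt_one)
  \<comment> \<open>\<open>B v\<close> is half the derivative of the quadratic form at the boundary
    point in direction \<open>v\<close>, and \<open>R v\<close> is the form evaluated at
    \<open>v\<close>.\<close>
  define B where "B v = p * (v \<bullet> axis1 \<theta>) / a + q * (v \<bullet> axis2 \<theta>) / b" for v
  define R where "R v = (v \<bullet> axis1 \<theta> / a)\<^sup>2 + (v \<bullet> axis2 \<theta> / b)\<^sup>2" for v
  have R: "R v \<ge> 0" for v by (simp add: R_def)
  have mem: "\<gamma> t + s *\<^sub>R v \<in> D \<longleftrightarrow> s * (2 * B v + s * R v) < 0" for s v
  proof -
    have e1: "(\<gamma> t + s *\<^sub>R v - c) \<bullet> axis1 \<theta> / a = p + s * (v \<bullet> axis1 \<theta> / a)"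
      using path_inner(1)[of t] a by (simp add: inner_add_left inner_diff_left p_def field_simps)
    have e2: "(\<gamma> t + s *\<^sub>R v - c) \<bullet> axis2 \<theta> / b = q + s * (v \<bullet> axis2 \<theta> / b)"
      using path_inner(2)[of t] b by (simp add: inner_add_left inner_diff_left q_def field_simps)
    have "(p + s * (v \<bullet> axis1 \<theta> / a))\<^sup>2 + (q + s * (v \<bullet> axis2 \<theta> / b))\<^sup>2
      = (p\<^sup>2 + q\<^sup>2) + s * (2 * B v + s * R v)"
      unfolding B_def R_def by (simp add: power2_eq_square algebra_simps)
    then show ?thesis unfolding mem_ellipse e1 e2 pq by simp
  qed
  have vn: "v \<bullet> ?n = a * b / speed t * B v" for v
    using a b speed_pos[of t] unfolding B_def p_def q_def by (simp add: inner_add_right field_simps)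
  have k: "a * b / speed t > 0" using a b speed_pos[of t] by simp
  show good: "norm ?n = 1 \<and>
        (\<forall>v. v \<bullet> ?n < 0 \<longrightarrow> (\<forall>\<^sub>F s in at_right 0. \<gamma> t + s *\<^sub>R v \<in> D)) \<and>
        (\<forall>v. v \<bullet> ?n > 0 \<longrightarrow> (\<forall>\<^sub>F s in at_right 0. \<gamma> t + s *\<^sub>R v \<notin> D))"
  proof (intro conjI allI impI n1)
    fix v assume "v \<bullet> ?n < 0"
    then have "2 * B v < 0" using k unfolding vn mult_less_0_iff by linarith
    moreover have "((\<lambda>s. 2 * B v + s * R v) \<longlongrightarrow> 2 * B v) (at_right 0)"
      by (auto intro!: tendsto_eq_intros)
    ultimately have "\<forall>\<^sub>F s in at_right 0. 2 * B v + s * R v < 0" by (rule order_tendstoD(2)[rotated])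
    then show "\<forall>\<^sub>F s in at_right 0. \<gamma> t + s *\<^sub>R v \<in> D"
      using eventually_at_right_less[of "0::real"] unfolding mem
      by eventually_elim (simp add: mult_pos_neg)
  next
    fix v assume "v \<bullet> ?n > 0"
    then have B: "B v > 0" using k unfolding vn zero_less_mult_iff by linarith
    show "\<forall>\<^sub>F s in at_right 0. \<gamma> t + s *\<^sub>R v \<notin> D"
      unfolding mem by (rule eventually_mono[OF eventually_at_right_less]) (use R[of v] B in \<open>simp add: not_less\<close>)
  qed
  fix n assume n: "norm n = 1 \<and>
        (\<forall>v. v \<bullet> n < 0 \<longrightarrow> (\<forall>\<^sub>F s in at_right 0. \<gamma> t + s *\<^sub>R v \<in> D)) \<and>
        (\<forall>v. v \<bullet> n > 0 \<longrightarrow> (\<forall>\<^sub>F s in at_right 0. \<gamma> t + s *\<^sub>R v \<notin> D))"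
  show "n = ?n"
  proof (rule ccontr)
    assume "n \<noteq> ?n"
    have "(norm (n - ?n))\<^sup>2 > 0" using \<open>n \<noteq> ?n\<close> by simp
    moreover have "(norm (n - ?n))\<^sup>2 = 2 - 2 * (n \<bullet> ?n)"
    proof -
      have "n \<bullet> n = 1" "?n \<bullet> ?n = 1" using n n1 by (simp_all add: norm_eq_1)
      then show ?thesis unfolding power2_norm_eq_inner
        by (simp only: inner_diff_left inner_diff_right inner_commute[of ?n n])
    qed
    ultimately have lt: "n \<bullet> ?n < 1" by simp
    \<comment> \<open>The difference of two distinct unit vectors points against one and along the
      other, so this direction would both enter and leave the ellipse.\<close>
    have "(n - ?n) \<bullet> ?n < 0" "(n - ?n) \<bullet> n > 0"
      using lt n n1 by (simp_all add: inner_diff_left norm_eq_1 inner_commute[of ?n n])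
    then have "\<forall>\<^sub>F s in at_right (0::real). \<gamma> t + s *\<^sub>R (n - ?n) \<in> D" "\<forall>\<^sub>F s in at_right (0::real). \<gamma> t + s *\<^sub>R (n - ?n) \<notin> D"
      using n good by blast+
    then have "\<forall>\<^sub>F s in at_right (0::real). False" by eventually_elim simp
    then show False by (simp add: trivial_limit_at_right_real)
  qed
qed

lemma norm_path_vector_derivative:
  assumes "t \<in> {0..1}"
  shows "norm (vector_derivative \<gamma> (at t within {0..1})) = 2 * pi * speed t"
proof -
  have "(\<gamma> has_vector_derivative ((2 * pi) * (- a * sin (2 * pi * t))) *\<^sub>R axis1 \<theta> + ((2 * pi) * (b * cos (2 * pi * t))) *\<^sub>R axis2 \<theta>) (at t within {0..1})"
    unfolding ellipse_path_def by (auto intro!: derivative_eq_intros simp: algebra_simps)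
  then have "vector_derivative \<gamma> (at t within {0..1}) = ((2 * pi) * (- a * sin (2 * pi * t))) *\<^sub>R axis1 \<theta> + ((2 * pi) * (b * cos (2 * pi * t))) *\<^sub>R axis2 \<theta>"
    using vector_derivative_within_cbox[of 0 1 t] assms by simp
  then have "(norm (vector_derivative \<gamma> (at t within {0..1})))\<^sup>2
      = ((2 * pi) * (- a * sin (2 * pi * t)))\<^sup>2 + ((2 * pi) * (b * cos (2 * pi * t)))\<^sup>2"
    by (simp only: norm_axis_combination)
  also have "\<dots> = (2 * pi * speed t)\<^sup>2"
    by (simp add: speed_def power_mult_distrib distrib_left)
  finally have "(norm (vector_derivative \<gamma> (at t within {0..1})))\<^sup>2 = (2 * pi * speed t)\<^sup>2" .
  then show ?thesis using speed_pos[of t] by (simp add: power2_eq_iff_nonneg)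
qed

section \<open>Arc-length integrals in the parameter\<close>

lemma speed_measurable [measurable]: "speed \<in> borel_measurable borel"
  by (intro borel_measurable_continuous_onI continuous_intros)

lemma path_measurable: "\<gamma> \<in> borel_measurable borel"
  by (intro borel_measurable_continuous_onI continuous_intros)

lemma arclength_measure_ellipse:
  "arclength_measure \<gamma> = distr (density unit_lborel (\<lambda>t. ennreal (2 * pi * speed t))) borel \<gamma>"
proof -
  have m: "(\<lambda>t. ennreal (2 * pi * speed t)) \<in> borel_measurable unit_lborel"
    by (intro measurable_unit_lborel) measurable
  have eq: "ennreal (norm (vector_derivative \<gamma> (at t within {0..1}))) = ennreal (2 * pi * speed t)"
    if "t \<in> space unit_lborel" for t
    using that norm_path_vector_derivative[of t] by (simp add: space_restrict_space)
  have m': "(\<lambda>t. ennreal (norm (vector_derivative \<gamma> (at t within {0..1})))) \<in> borel_measurable unit_lborel"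
    by (rule iffD2[OF measurable_cong m]) (rule eq)
  show ?thesis unfolding arclength_measure_def
    by (rule arg_cong[where f = "\<lambda>M. distr M borel \<gamma>"], rule density_cong[OF m' m]) (use eq in auto)
qed

lemma sets_arclength_ellipse [measurable_cong, simp]: "sets (arclength_measure \<gamma>) = sets borel"
  by (simp add: arclength_measure_def)

lemma
  fixes f :: "real^2 \<Rightarrow> 'b::{banach, second_countable_topology}"
  assumes f [measurable]: "f \<in> borel_measurable borel"
  shows integrable_arclength_ellipse:
      "integrable (arclength_measure \<gamma>) f \<longleftrightarrow> integrable unit_lborel (\<lambda>t. (2 * pi * speed t) *\<^sub>R f (\<gamma> t))"
    and integral_arclength_ellipse:
      "integral\<^sup>L (arclength_measure \<gamma>) f = integral\<^sup>L unit_lborel (\<lambda>t. (2 * pi * speed t) *\<^sub>R f (\<gamma> t))"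
proof -
  have s: "(\<lambda>t. 2 * pi * speed t) \<in> borel_measurable unit_lborel"
    by (intro measurable_unit_lborel) measurable
  have g: "\<gamma> \<in> borel_measurable unit_lborel" by (intro measurable_unit_lborel path_measurable)
  then have g': "\<gamma> \<in> measurable (density unit_lborel (\<lambda>t. ennreal (2 * pi * speed t))) borel" by simp
  have fg: "(\<lambda>t. f (\<gamma> t)) \<in> borel_measurable unit_lborel" using g by measurable
  have nn: "AE t in unit_lborel. 0 \<le> 2 * pi * speed t" using speed_pos by (auto intro!: AE_I2 less_imp_le)
  show "integrable (arclength_measure \<gamma>) f \<longleftrightarrow> integrable unit_lborel (\<lambda>t. (2 * pi * speed t) *\<^sub>R f (\<gamma> t))"
    unfolding arclength_measure_ellipse integrable_distr_eq[OF g' f] integrable_density[OF fg s nn] ..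
  show "integral\<^sup>L (arclength_measure \<gamma>) f = integral\<^sup>L unit_lborel (\<lambda>t. (2 * pi * speed t) *\<^sub>R f (\<gamma> t))"
    unfolding arclength_measure_ellipse integral_distr[OF g' f] integral_density[OF fg s nn] ..
qed

text \<open>The density \<open>2 * pi * speed t\<close> is strictly positive, so null sets of the
  weighted measure are null for the unweighted one.\<close>

lemma AE_arclength_D:
  assumes "AE x in arclength_measure \<gamma>. P x"
  shows "AE t in unit_lborel. P (\<gamma> t)"
proof -
  have "\<gamma> \<in> borel_measurable unit_lborel" by (intro measurable_unit_lborel path_measurable)
  then have "AE t in density unit_lborel (\<lambda>t. ennreal (2 * pi * speed t)). P (\<gamma> t)"
    using assms unfolding arclength_measure_ellipse by (intro AE_distrD[of \<gamma> _ borel]) simp_all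
  moreover have "(\<lambda>t. ennreal (2 * pi * speed t)) \<in> borel_measurable unit_lborel"
    by (intro measurable_unit_lborel) measurable
  ultimately show ?thesis using speed_pos by (simp add: AE_density)
qed

text \<open>The arc-length measure lives on the whole plane; the complement of the closed set
  \<open>path_image \<gamma>\<close> is null for it.\<close>

lemma AE_arclength_I:
  assumes "\<And>t. t \<in> {0..1} \<Longrightarrow> P (\<gamma> t)"
  shows "AE x in arclength_measure \<gamma>. P x"
proof -
  have "closed (path_image \<gamma>)"
    unfolding path_image_def by (intro compact_imp_closed compact_continuous_image continuous_path) simp
  then have meas: "{x \<in> space borel. x \<in> path_image \<gamma>} \<in> sets borel" by simp
  have "\<gamma> \<in> measurable (density unit_lborel (\<lambda>t. ennreal (2 * pi * speed t))) borel"
    using measurable_unit_lborel[OF path_measurable] by simp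
  then have "AE x in arclength_measure \<gamma>. x \<in> path_image \<gamma>"
    unfolding arclength_measure_ellipse
    by (subst AE_distr_iff[OF _ meas]) (auto simp: path_image_def space_restrict_space intro!: AE_I2)
  then show ?thesis by eventually_elim (auto simp: path_image_def assms)
qed

text \<open>Numerator and squared distance share the factor 1 - cos (2 pi (t - s)), which carries
  the singularity on the diagonal. After cancellation only a function of \<open>t + s\<close>
  remains.\<close>

lemma NP_kernel_ellipse:
  assumes "\<gamma> t \<noteq> \<gamma> s"
  shows "speed t * (((\<gamma> t - \<gamma> s) \<bullet> outward_unit_normal D (\<gamma> t)) / (norm (\<gamma> t - \<gamma> s))\<^sup>2)
     = poisson ratio (t + s)"
proof -
  define p q p' q' where "p = cos (2 * pi * t)" "q = sin (2 * pi * t)" "p' = cos (2 * pi * s)" "q' = sin (2 * pi * s)"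
  note defs = this
  have pq: "p\<^sup>2 + q\<^sup>2 = 1" "p'\<^sup>2 + q'\<^sup>2 = 1" by (simp_all add: defs)
  have diff: "\<gamma> t - \<gamma> s = (a * (p - p')) *\<^sub>R axis1 \<theta> + (b * (q - q')) *\<^sub>R axis2 \<theta>"
    by (simp add: ellipse_path_def defs algebra_simps)
  have n: "(norm (\<gamma> t - \<gamma> s))\<^sup>2 = (a * (p - p'))\<^sup>2 + (b * (q - q'))\<^sup>2"
    unfolding diff norm_axis_combination ..
  have npos: "(norm (\<gamma> t - \<gamma> s))\<^sup>2 > 0" using assms by simp
  have "(\<gamma> t - \<gamma> s) \<bullet> outward_unit_normal D (\<gamma> t) = (a * (p - p') * (b * p) + b * (q - q') * (a * q)) / speed t"
    unfolding outward_unit_normal_ellipse diff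
    by (simp add: inner_add_left inner_add_right defs add_divide_distrib mult.commute)
  then have "speed t * ((\<gamma> t - \<gamma> s) \<bullet> outward_unit_normal D (\<gamma> t)) = a * (p - p') * (b * p) + b * (q - q') * (a * q)"
    using speed_pos[of t] by simp
  also have "\<dots> = a * b * (1 - p * p' - q * q')"
    using pq by algebra
  finally have num: "speed t * ((\<gamma> t - \<gamma> s) \<bullet> outward_unit_normal D (\<gamma> t)) = a * b * (1 - p * p' - q * q')" .
  have cs: "cos (2 * pi * (t + s)) = p * p' - q * q'"
    by (simp add: defs distrib_left cos_add)
  have ab: "a + b \<noteq> 0" using a b by simp
  \<comment> \<open>The denominator of the Poisson kernel, scaled by
    \<open>(a + b)\<^sup>2 / 2\<close>.\<close>
  define d where "d = (a\<^sup>2 + b\<^sup>2) - (a\<^sup>2 - b\<^sup>2) * (p * p' - q * q')"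
  have r: "ratio * (a + b) = a - b" using ab by (simp add: ratio_def)
  have "(1 - 2 * ratio * (p * p' - q * q') + ratio\<^sup>2) * (a + b)\<^sup>2 = 2 * d"
    unfolding d_def using r by algebra
  then have den: "1 - 2 * ratio * (p * p' - q * q') + ratio\<^sup>2 = 2 * d / (a + b)\<^sup>2"
    using ab by (simp add: eq_divide_eq)
  have dpos: "d > 0" using poisson_denominator[OF abs_ratio, of "2 * pi * (t + s)"] ab
    unfolding cs den by (simp add: zero_less_divide_iff)
  have "(1 - ratio\<^sup>2) * (a + b)\<^sup>2 = 4 * a * b" using r by algebra
  then have n1: "1 - ratio\<^sup>2 = 4 * a * b / (a + b)\<^sup>2" using ab by (simp add: eq_divide_eq)
  have P: "poisson ratio (t + s) = a * b / d"
    unfolding poisson_def cs den n1 using ab dpos by simp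
  \<comment> \<open>Here \<open>p * p' + q * q'\<close> is the cosine of
    \<open>2 * pi * (t - s)\<close>; the squared distance is the shared factor times
    \<open>d\<close>.\<close>
  have *: "a * b * (1 - p * p' - q * q') * d = a * b * (norm (\<gamma> t - \<gamma> s))\<^sup>2"
    unfolding n d_def using pq by algebra
  from * have "a * b * (1 - p * p' - q * q') / (norm (\<gamma> t - \<gamma> s))\<^sup>2 = a * b / d"
    using npos dpos by (subst frac_eq_eq) auto
  then show ?thesis unfolding num[symmetric] P by simp
qed

end

subsection \<open>Resolvent and polarization tensor\<close>

lemma borel_measurable_poisson_sum:
  assumes "\<bar>e\<bar> < 1"
  shows "(\<lambda>(t, s). complex_of_real (poisson e (t + s))) \<in> borel_measurable (unit_lborel \<Otimes>\<^sub>M unit_lborel)"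
proof -
  have id: "(\<lambda>t. t) \<in> borel_measurable unit_lborel" by (intro measurable_restrict_space1) simp
  have p: "poisson e \<in> borel_measurable borel"
    by (intro borel_measurable_continuous_onI continuous_intros assms)
  have "(\<lambda>x. fst x + snd x :: real) \<in> borel_measurable (unit_lborel \<Otimes>\<^sub>M unit_lborel)"
    by (intro borel_measurable_add measurable_compose[OF measurable_fst id] measurable_compose[OF measurable_snd id])
  from measurable_compose[OF this p] show ?thesis unfolding case_prod_unfold by simp
qed

context elliptic_boundary
begin

text \<open>The speed at \<open>s\<close> is the arc-length Jacobian, and the speed at
  \<open>t\<close> cancels the normalization of the normal there. Weighting densities by the speed
  therefore leaves a symmetric kernel.\<close>

lemma NP_adjoint_ellipse:
  assumes t: "t \<in> {0..1}" and \<psi> [measurable]: "\<psi> \<in> borel_measurable borel"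
  shows "(2 * pi * speed t) *\<^sub>R NP_adjoint D \<gamma> \<psi> (\<gamma> t)
    = (\<integral>s. of_real (poisson ratio (t + s)) * ((2 * pi * speed s) *\<^sub>R \<psi> (\<gamma> s)) \<partial>unit_lborel)"
proof -
  define k where "k y = complex_of_real (((\<gamma> t - y) \<bullet> outward_unit_normal D (\<gamma> t)) / (norm (\<gamma> t - y))\<^sup>2)" for y
  have [measurable]: "k \<in> borel_measurable borel" unfolding k_def by measurable
  have "speed t *\<^sub>R k (\<gamma> s) = of_real (poisson ratio (t + s))" if "\<gamma> s \<noteq> \<gamma> t" for s
    unfolding k_def scaleR_conv_of_real of_real_mult[symmetric] NP_kernel_ellipse[OF that[symmetric]] ..
  \<comment> \<open>The path is simple and closed, so it can return to the point at \<open>t\<close>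
    only at \<open>s = t\<close> or at an endpoint of the interval; these three parameters form a
    null set.\<close>
  moreover have "AE s in unit_lborel. \<gamma> s \<noteq> \<gamma> t"
  proof -
    have "AE s in lborel. s \<noteq> 0 \<and> s \<noteq> 1 \<and> s \<noteq> t"
      using AE_lborel_singleton[of "0::real"] AE_lborel_singleton[of "1::real"] AE_lborel_singleton[of t]
      by eventually_elim simp
    then have "AE s in unit_lborel. s \<noteq> 0 \<and> s \<noteq> 1 \<and> s \<noteq> t"
      by (simp add: AE_restrict_space_iff) (auto elim: eventually_mono)
    moreover have "AE s in unit_lborel. s \<in> {0..1}" by (rule AE_I2) (simp add: space_restrict_space)
    ultimately show ?thesis
    proof eventually_elim
      case (elim s)
      then show ?case
        using simple_path_ellipse_path(1)[OF a b, of c \<theta>] t unfolding simple_path_def loop_free_def by metis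
    qed
  qed
  ultimately have AE: "AE s in unit_lborel. of_real (2 * pi * speed t) * ((2 * pi * speed s) *\<^sub>R (k (\<gamma> s) * \<psi> (\<gamma> s)))
       = 2 * pi * (of_real (poisson ratio (t + s)) * ((2 * pi * speed s) *\<^sub>R \<psi> (\<gamma> s)))"
  proof (elim eventually_mono)
    fix s assume "\<And>s. \<gamma> s \<noteq> \<gamma> t \<Longrightarrow> speed t *\<^sub>R k (\<gamma> s) = of_real (poisson ratio (t + s))" "\<gamma> s \<noteq> \<gamma> t"
    then have P: "of_real (poisson ratio (t + s)) = of_real (speed t) * k (\<gamma> s)" by (simp add: scaleR_conv_of_real)
    show "of_real (2 * pi * speed t) * ((2 * pi * speed s) *\<^sub>R (k (\<gamma> s) * \<psi> (\<gamma> s)))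
       = 2 * pi * (of_real (poisson ratio (t + s)) * ((2 * pi * speed s) *\<^sub>R \<psi> (\<gamma> s)))"
      unfolding P by (simp add: scaleR_conv_of_real)
  qed
  have [measurable]: "\<gamma> \<in> borel_measurable unit_lborel" "speed \<in> borel_measurable unit_lborel"
    "(\<lambda>s. poisson ratio (t + s)) \<in> borel_measurable unit_lborel"
    by (intro measurable_unit_lborel path_measurable speed_measurable borel_measurable_continuous_onI
        continuous_intros abs_ratio)+
  have "NP_adjoint D \<gamma> \<psi> (\<gamma> t) = of_real (1 / (2 * pi)) * (\<integral>s. (2 * pi * speed s) *\<^sub>R (k (\<gamma> s) * \<psi> (\<gamma> s)) \<partial>unit_lborel)"
    unfolding NP_adjoint_def k_def[symmetric] by (subst integral_arclength_ellipse) simp_all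
  then have "(2 * pi * speed t) *\<^sub>R NP_adjoint D \<gamma> \<psi> (\<gamma> t)
      = of_real (1 / (2 * pi)) * (\<integral>s. of_real (2 * pi * speed t) * ((2 * pi * speed s) *\<^sub>R (k (\<gamma> s) * \<psi> (\<gamma> s))) \<partial>unit_lborel)"
    by (subst integral_mult_right_zero) (simp add: scaleR_conv_of_real)
  also have "(\<integral>s. of_real (2 * pi * speed t) * ((2 * pi * speed s) *\<^sub>R (k (\<gamma> s) * \<psi> (\<gamma> s))) \<partial>unit_lborel)
      = (\<integral>s. 2 * pi * (of_real (poisson ratio (t + s)) * ((2 * pi * speed s) *\<^sub>R \<psi> (\<gamma> s))) \<partial>unit_lborel)"
    by (rule integral_cong_AE[OF _ _ AE]) measurable
  also have "of_real (1 / (2 * pi)) * \<dots>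
      = (\<integral>s. of_real (poisson ratio (t + s)) * ((2 * pi * speed s) *\<^sub>R \<psi> (\<gamma> s)) \<partial>unit_lborel)"
    by (subst integral_mult_right_zero) simp
  finally show ?thesis .
qed

text \<open>The weighted normal component: the speed cancels, leaving a combination of the two
  eigenfunctions cosine and sine.\<close>

definition NP_source :: "2 \<Rightarrow> real \<Rightarrow> complex" where
  "NP_source m t = of_real (2 * pi * (b * axis1 \<theta> $ m * cos (2 * pi * t) + a * axis2 \<theta> $ m * sin (2 * pi * t)))"

lemma normal_eq_source:
  "(2 * pi * speed t) *\<^sub>R complex_of_real (outward_unit_normal D (\<gamma> t) $ m) = NP_source m t"
proof -
  have "2 * pi * speed t * outward_unit_normal D (\<gamma> t) $ m
      = 2 * pi * (b * axis1 \<theta> $ m * cos (2 * pi * t) + a * axis2 \<theta> $ m * sin (2 * pi * t))"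
    using speed_pos[of t] unfolding outward_unit_normal_ellipse by (simp add: field_simps)
  moreover have "x *\<^sub>R complex_of_real y = of_real (x * y)" for x y by (simp add: scaleR_conv_of_real)
  ultimately show ?thesis unfolding NP_source_def by metis
qed

lemma resolvent_equation_ellipse:
  assumes t: "t \<in> {0..1}" and \<psi>: "\<psi> \<in> borel_measurable borel"
  shows "lam * \<psi> (\<gamma> t) - NP_adjoint D \<gamma> \<psi> (\<gamma> t) = complex_of_real (outward_unit_normal D (\<gamma> t) $ m)
    \<longleftrightarrow> lam * ((2 * pi * speed t) *\<^sub>R \<psi> (\<gamma> t))
        - (\<integral>s. of_real (poisson ratio (t + s)) * ((2 * pi * speed s) *\<^sub>R \<psi> (\<gamma> s)) \<partial>unit_lborel) = NP_source m t"
proof -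
  have "u - v = w \<longleftrightarrow> (2 * pi * speed t) *\<^sub>R u - (2 * pi * speed t) *\<^sub>R v = (2 * pi * speed t) *\<^sub>R w" for u v w :: complex
    using speed_pos[of t] by (simp flip: scaleR_diff_right)
  then show ?thesis unfolding NP_adjoint_ellipse[OF t \<psi>, symmetric] normal_eq_source[symmetric] by simp
qed

lemma square_integrable_if_continuous:
  assumes "\<psi> \<in> borel_measurable borel" "continuous_on {0..1} (\<lambda>t. \<psi> (\<gamma> t))"
  shows "square_integrable (arclength_measure \<gamma>) \<psi>"
  unfolding square_integrable_def
proof
  show "\<psi> \<in> borel_measurable (arclength_measure \<gamma>)" using assms(1) by simp
  have "(\<lambda>x. (cmod (\<psi> x))\<^sup>2) \<in> borel_measurable borel" using assms(1) by measurable
  then show "integrable (arclength_measure \<gamma>) (\<lambda>x. (cmod (\<psi> x))\<^sup>2)"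
    by (subst integrable_arclength_ellipse)
      (auto intro!: integrable_unit_lborel continuous_intros assms(2))
qed

text \<open>The curve has finite length, so square-integrable functions are integrable; the
  domination is u <= 1 + u^2.\<close>

lemma square_integrable_imp_integrable:
  assumes "square_integrable (arclength_measure \<gamma>) \<psi>"
  shows "integrable (arclength_measure \<gamma>) \<psi>"
proof -
  have [measurable]: "\<psi> \<in> borel_measurable (arclength_measure \<gamma>)" using assms by (simp add: square_integrable_def)
  have "integrable (arclength_measure \<gamma>) (\<lambda>x. 1 :: real)"
    by (subst integrable_arclength_ellipse) (auto intro!: integrable_unit_lborel continuous_intros)
  then have "integrable (arclength_measure \<gamma>) (\<lambda>x. 1 + (cmod (\<psi> x))\<^sup>2)"
    using assms by (auto simp: square_integrable_def)
  then show ?thesis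
  proof (rule Bochner_Integration.integrable_bound)
    have "u \<le> 1 + u\<^sup>2" for u :: real
      using zero_le_power2[of "2 * u - 1"] by (simp add: power2_eq_square algebra_simps)
    then show "AE x in arclength_measure \<gamma>. norm (\<psi> x) \<le> norm (1 + (cmod (\<psi> x))\<^sup>2)"
      by (intro AE_I2) (auto intro: order_trans[OF _ abs_ge_self])
  qed measurable
qed

text \<open>\<open>NP_resolvent\<close> is a choice, so its defining property is available only once
  some solution is exhibited. Dividing the two coefficients of the source by \<open>lam\<close>
  minus the respective eigenvalue gives one.\<close>

lemma resolvent_exists:
  fixes lam :: complex
  assumes lam: "lam \<noteq> ratio / 2" "lam \<noteq> - ratio / 2"
  shows "\<exists>\<phi>. square_integrable (arclength_measure \<gamma>) \<phi> \<and>
        (AE x in arclength_measure \<gamma>. lam * \<phi> x - NP_adjoint D \<gamma> \<phi> x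
           = complex_of_real (outward_unit_normal D x $ m))"
proof (intro exI conjI)
  \<comment> \<open>The solution must be a function on the plane; \<open>W\<close> extends the speed
    off the curve by reading cosine and sine from the coordinates of \<open>x\<close>.\<close>
  define W where "W x = sqrt ((a * ((x - c) \<bullet> axis2 \<theta> / b))\<^sup>2 + (b * ((x - c) \<bullet> axis1 \<theta> / a))\<^sup>2)" for x
  define k1 k2 where "k1 = of_real (axis1 \<theta> $ m * b) / (lam - ratio / 2)"
    "k2 = of_real (axis2 \<theta> $ m * a) / (lam + ratio / 2)"
  define \<phi> where "\<phi> x = (k1 * of_real ((x - c) \<bullet> axis1 \<theta> / a) + k2 * of_real ((x - c) \<bullet> axis2 \<theta> / b)) / of_real (W x)" for x
  have [measurable]: "W \<in> borel_measurable borel" unfolding W_def by measurable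
  have meas: "\<phi> \<in> borel_measurable borel" unfolding \<phi>_def by measurable
  have W: "W (\<gamma> t) = speed t" for t using a b by (simp add: W_def path_inner speed_def)
  have \<phi>: "\<phi> (\<gamma> t) = (k1 * of_real (cos (2 * pi * t)) + k2 * of_real (sin (2 * pi * t))) / of_real (speed t)" for t
    unfolding \<phi>_def W path_inner using a b by simp
  show "square_integrable (arclength_measure \<gamma>) \<phi>"
    by (rule square_integrable_if_continuous[OF meas])
      (unfold \<phi>, intro continuous_intros ballI, use speed_pos in \<open>simp add: less_imp_neq[symmetric]\<close>)
  show "AE x in arclength_measure \<gamma>. lam * \<phi> x - NP_adjoint D \<gamma> \<phi> x = complex_of_real (outward_unit_normal D x $ m)"
  proof (rule AE_arclength_I)
    fix t :: real assume t: "t \<in> {0..1}"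
    have \<Phi>: "(2 * pi * speed s) *\<^sub>R \<phi> (\<gamma> s) = 2 * pi * k1 * of_real (cos (2 * pi * s)) + 2 * pi * k2 * of_real (sin (2 * pi * s))" for s
      unfolding \<phi> scaleR_conv_of_real using speed_pos[of s] by (simp add: field_simps)
    let ?P = "\<lambda>s. complex_of_real (poisson ratio (s + t))"
    have i: "integrable unit_lborel (\<lambda>s. ?P s * of_real (cos (2 * pi * s)))"
      "integrable unit_lborel (\<lambda>s. ?P s * of_real (sin (2 * pi * s)))"
      by (intro integrable_unit_lborel continuous_intros abs_ratio)+
    have "(\<integral>s. of_real (poisson ratio (t + s)) * ((2 * pi * speed s) *\<^sub>R \<phi> (\<gamma> s)) \<partial>unit_lborel)
       = (\<integral>s. 2 * pi * k1 * (?P s * of_real (cos (2 * pi * s))) + 2 * pi * k2 * (?P s * of_real (sin (2 * pi * s))) \<partial>unit_lborel)"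
      unfolding \<Phi> add.commute[of t] by (simp add: algebra_simps)
    also have "\<dots> = 2 * pi * k1 * of_real (ratio / 2 * cos (2 * pi * t)) + 2 * pi * k2 * of_real (- ratio / 2 * sin (2 * pi * t))"
      using i by (subst Bochner_Integration.integral_add) (simp_all only: integrable_mult_right integral_mult_right_zero
          integral_poisson_cos_sin[OF abs_ratio])
    finally have I: "(\<integral>s. of_real (poisson ratio (t + s)) * ((2 * pi * speed s) *\<^sub>R \<phi> (\<gamma> s)) \<partial>unit_lborel) = \<dots>" .
    have "k1 * (lam - ratio / 2) = of_real (axis1 \<theta> $ m * b)" "k2 * (lam + ratio / 2) = of_real (axis2 \<theta> $ m * a)"
      using lam unfolding k1_k2_def by (auto simp: add_eq_0_iff2)
    then have "NP_source m t = 2 * pi * (k1 * (lam - ratio / 2) * of_real (cos (2 * pi * t)) + k2 * (lam + ratio / 2) * of_real (sin (2 * pi * t)))"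
      by (simp add: NP_source_def mult_ac)
    then show "lam * \<phi> (\<gamma> t) - NP_adjoint D \<gamma> \<phi> (\<gamma> t) = complex_of_real (outward_unit_normal D (\<gamma> t) $ m)"
      unfolding resolvent_equation_ellipse[OF t meas] I unfolding \<Phi> by (simp add: algebra_simps)
  qed
qed

text \<open>Each moment comes from testing with one eigenfunction, so the values hold for whichever
  solution the choice returns. These three moments suffice because the coordinates of the path are
  combinations of 1, cosine and sine.\<close>

lemma resolvent_moments:
  fixes lam :: complex
  assumes lam: "lam \<noteq> ratio / 2" "lam \<noteq> - ratio / 2" "lam \<noteq> 1 / 2"
  defines "\<phi> \<equiv> \<lambda>m. NP_resolvent lam D \<gamma> (\<lambda>y. complex_of_real (outward_unit_normal D y $ m))"
  defines "\<Phi> \<equiv> \<lambda>m t. (2 * pi * speed t) *\<^sub>R \<phi> m (\<gamma> t)"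
  shows "\<phi> m \<in> borel_measurable borel" and "integrable unit_lborel (\<Phi> m)"
    and "(\<integral>t. \<Phi> m t \<partial>unit_lborel) = 0"
    and "(\<integral>t. \<Phi> m t * of_real (cos (2 * pi * t)) \<partial>unit_lborel) = pi * b * of_real (axis1 \<theta> $ m) / (lam - ratio / 2)"
    and "(\<integral>t. \<Phi> m t * of_real (sin (2 * pi * t)) \<partial>unit_lborel) = pi * a * of_real (axis2 \<theta> $ m) / (lam + ratio / 2)"
proof -
  have sol: "square_integrable (arclength_measure \<gamma>) (\<phi> m) \<and>
        (AE x in arclength_measure \<gamma>. lam * \<phi> m x - NP_adjoint D \<gamma> (\<phi> m) x
           = complex_of_real (outward_unit_normal D x $ m))"
    unfolding \<phi>_def NP_resolvent_def by (rule someI_ex[OF resolvent_exists[OF lam(1,2)]])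
  then show meas: "\<phi> m \<in> borel_measurable borel"
    unfolding square_integrable_def measurable_cong_sets[OF sets_arclength_ellipse refl] by blast
  show int: "integrable unit_lborel (\<Phi> m)"
    using square_integrable_imp_integrable[of "\<phi> m"] sol integrable_arclength_ellipse[OF meas] by (simp add: \<Phi>_def)
  have "AE t in unit_lborel. t \<in> {0..1}" by (rule AE_I2) (simp add: space_restrict_space)
  with AE_arclength_D[OF conjunct2[OF sol]]
  have eq: "AE t in unit_lborel. lam * \<Phi> m t - (\<integral>s. of_real (poisson ratio (t + s)) * \<Phi> m s \<partial>unit_lborel) = NP_source m t"
    by eventually_elim (use resolvent_equation_ellipse[OF _ meas] in \<open>auto simp: \<Phi>_def\<close>)
  have tested: "(lam - \<kappa>) * (\<integral>t. \<Phi> m t * of_real (E t) \<partial>unit_lborel) = (\<integral>t. NP_source m t * of_real (E t) \<partial>unit_lborel)"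
    if E: "continuous_on UNIV E" "\<And>t. \<bar>E t\<bar> \<le> 1"
      and eig: "\<And>s. (\<integral>t. of_real (poisson ratio (t + s)) * of_real (E t) \<partial>unit_lborel) = \<kappa> * of_real (E s)"
    for \<kappa> :: complex and E :: "real \<Rightarrow> real"
  proof (rule symmetric_kernel_tested[OF finite_measure_unit_lborel borel_measurable_poisson_sum[OF abs_ratio]
        norm_poisson_le[OF abs_ratio] _ _ eig int eq])
    show "(\<lambda>t. complex_of_real (E t)) \<in> borel_measurable unit_lborel"
      by (intro measurable_unit_lborel borel_measurable_continuous_onI continuous_intros E(1))
    show "cmod (complex_of_real (E t)) \<le> 1" for t using E(2) by simp
    show "integrable unit_lborel (\<lambda>t. NP_source m t * complex_of_real (E t))" unfolding NP_source_def
      by (intro integrable_unit_lborel continuous_intros continuous_on_subset[OF E(1)]) simp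
  qed
  have src: "(\<integral>t. NP_source m t * of_real (E t) \<partial>unit_lborel)
     = complex_of_real (2 * pi * b * axis1 \<theta> $ m * (\<integral>t. cos (2 * pi * t) * E t \<partial>unit_lborel)
        + 2 * pi * a * axis2 \<theta> $ m * (\<integral>t. sin (2 * pi * t) * E t \<partial>unit_lborel))"
    if E: "continuous_on UNIV E" for E :: "real \<Rightarrow> real"
  proof -
    have i: "integrable unit_lborel (\<lambda>t. cos (2 * pi * t) * E t)" "integrable unit_lborel (\<lambda>t. sin (2 * pi * t) * E t)"
      by (intro integrable_unit_lborel continuous_intros continuous_on_subset[OF E] subset_UNIV)+
    have "NP_source m t * of_real (E t) = complex_of_real (2 * pi * b * axis1 \<theta> $ m * (cos (2 * pi * t) * E t)
        + 2 * pi * a * axis2 \<theta> $ m * (sin (2 * pi * t) * E t))" for t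
      unfolding NP_source_def by (simp add: algebra_simps)
    then show ?thesis using i by (simp del: of_real_add of_real_mult)
  qed
  have "(lam - 1 / 2) * (\<integral>t. \<Phi> m t * of_real 1 \<partial>unit_lborel) = (\<integral>t. NP_source m t * of_real 1 \<partial>unit_lborel)"
    by (rule tested) (simp_all only: integral_poisson[OF abs_ratio] of_real_1 mult_1_right abs_one continuous_on_const order_refl)
  also have "\<dots> = 0"
    by (subst src) (simp_all add: integral_unit_lborel_trig)
  finally show "(\<integral>t. \<Phi> m t \<partial>unit_lborel) = 0" using lam(3) by simp
  have "(lam - ratio / 2) * (\<integral>t. \<Phi> m t * of_real (cos (2 * pi * t)) \<partial>unit_lborel) = pi * b * of_real (axis1 \<theta> $ m)"
    by (subst tested[where E = "\<lambda>t. cos (2 * pi * t)"])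
      (simp_all add: integral_poisson_cos_sin[OF abs_ratio] src integral_unit_lborel_trig continuous_intros
        flip: power2_eq_square)
  then show "(\<integral>t. \<Phi> m t * of_real (cos (2 * pi * t)) \<partial>unit_lborel) = pi * b * of_real (axis1 \<theta> $ m) / (lam - ratio / 2)"
    using lam(1) by (simp add: field_simps)
  have "(lam - (- ratio / 2)) * (\<integral>t. \<Phi> m t * of_real (sin (2 * pi * t)) \<partial>unit_lborel) = pi * a * of_real (axis2 \<theta> $ m)"
    by (subst tested[where E = "\<lambda>t. sin (2 * pi * t)"])
      (simp_all add: integral_poisson_cos_sin[OF abs_ratio] src integral_unit_lborel_trig continuous_intros
        mult.commute[of "cos _" "sin _"] flip: power2_eq_square)
  then show "(\<integral>t. \<Phi> m t * of_real (sin (2 * pi * t)) \<partial>unit_lborel) = pi * a * of_real (axis2 \<theta> $ m) / (lam + ratio / 2)"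
    using lam(2) by (simp add: eq_divide_eq add_eq_0_iff2 mult.commute)
qed

text \<open>The centre drops out because the solution has mean zero. Summing the diagonal entries
  removes the angle, as the axes are unit vectors.\<close>

lemma trace_polarization_tensor_ellipse:
  fixes lam :: complex
  assumes lam: "lam \<noteq> ratio / 2" "lam \<noteq> - ratio / 2" "lam \<noteq> 1 / 2"
  shows "trace (polarization_tensor lam D \<gamma>) = of_real (pi * a * b) * (1 / (lam - ratio / 2) + 1 / (lam + ratio / 2))"
proof -
  define \<phi> where "\<phi> m = NP_resolvent lam D \<gamma> (\<lambda>y. complex_of_real (outward_unit_normal D y $ m))" for m
  define \<Phi> where "\<Phi> m t = (2 * pi * speed t) *\<^sub>R \<phi> m (\<gamma> t)" for m t
  note mom = resolvent_moments[OF lam, folded \<phi>_def, folded \<Phi>_def]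
  have entry: "polarization_tensor lam D \<gamma> $ m $ m
      = pi * a * b * ((of_real (axis1 \<theta> $ m))\<^sup>2 / (lam - ratio / 2) + (of_real (axis2 \<theta> $ m))\<^sup>2 / (lam + ratio / 2))" for m
  proof -
    have [measurable]: "\<phi> m \<in> borel_measurable borel" by (rule mom)
    have bnd: "integrable unit_lborel (\<lambda>t. \<Phi> m t * of_real (E t))"
      if "continuous_on UNIV E" "\<And>t. \<bar>E t\<bar> \<le> 1" for E :: "real \<Rightarrow> real"
    proof (rule Bochner_Integration.integrable_bound[OF mom(2)[of m]])
      have "(\<lambda>t. complex_of_real (E t)) \<in> borel_measurable unit_lborel"
        by (intro measurable_unit_lborel borel_measurable_continuous_onI continuous_intros that(1))
      then show "(\<lambda>t. \<Phi> m t * of_real (E t)) \<in> borel_measurable unit_lborel" using mom(2)[of m] by simp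
      show "AE t in unit_lborel. norm (\<Phi> m t * of_real (E t)) \<le> norm (\<Phi> m t)"
        using that(2) by (intro AE_I2) (simp add: norm_mult mult_left_le)
    qed
    have i: "integrable unit_lborel (\<lambda>t. \<Phi> m t * of_real (cos (2 * pi * t)))"
      "integrable unit_lborel (\<lambda>t. \<Phi> m t * of_real (sin (2 * pi * t)))"
      by (intro bnd continuous_intros abs_cos_le_one abs_sin_le_one)+
    have "polarization_tensor lam D \<gamma> $ m $ m = (\<integral>t. (2 * pi * speed t) *\<^sub>R (of_real (\<gamma> t $ m) * \<phi> m (\<gamma> t)) \<partial>unit_lborel)"
      unfolding polarization_tensor_def \<phi>_def[symmetric] by (simp add: integral_arclength_ellipse)
    also have "\<dots> = (\<integral>t. of_real (c $ m) * \<Phi> m t + (of_real (a * axis1 \<theta> $ m) * (\<Phi> m t * of_real (cos (2 * pi * t)))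
          + of_real (b * axis2 \<theta> $ m) * (\<Phi> m t * of_real (sin (2 * pi * t)))) \<partial>unit_lborel)"
      unfolding \<Phi>_def ellipse_path_def by (simp add: algebra_simps)
    also have "\<dots> = of_real (a * axis1 \<theta> $ m) * (pi * b * of_real (axis1 \<theta> $ m) / (lam - ratio / 2))
          + of_real (b * axis2 \<theta> $ m) * (pi * a * of_real (axis2 \<theta> $ m) / (lam + ratio / 2))"
      using i mom(2)[of m]
      by (simp only: Bochner_Integration.integral_add Bochner_Integration.integrable_add integrable_mult_right
          integral_mult_right_zero mom(3,4,5)) simp
    finally show ?thesis by (simp add: power2_eq_square algebra_simps)
  qed
  have "complex_of_real ((axis1 \<theta> $ 1)\<^sup>2 + (axis1 \<theta> $ 2)\<^sup>2) = 1" "complex_of_real ((axis2 \<theta> $ 1)\<^sup>2 + (axis2 \<theta> $ 2)\<^sup>2) = 1"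
    by (simp_all add: axis1_def axis2_def)
  then have ax: "(complex_of_real (axis1 \<theta> $ 1))\<^sup>2 + (complex_of_real (axis1 \<theta> $ 2))\<^sup>2 = 1"
    "(complex_of_real (axis2 \<theta> $ 1))\<^sup>2 + (complex_of_real (axis2 \<theta> $ 2))\<^sup>2 = 1" by simp_all
  have "trace (polarization_tensor lam D \<gamma>)
     = pi * a * b * (((of_real (axis1 \<theta> $ 1))\<^sup>2 + (of_real (axis1 \<theta> $ 2))\<^sup>2) / (lam - ratio / 2)
        + ((of_real (axis2 \<theta> $ 1))\<^sup>2 + (of_real (axis2 \<theta> $ 2))\<^sup>2) / (lam + ratio / 2))"
    unfolding trace_def sum_2 entry by (simp add: add_divide_distrib algebra_simps)
  also have "\<dots> = of_real (pi * a * b) * (1 / (lam - ratio / 2) + 1 / (lam + ratio / 2))"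
    unfolding ax by simp
  finally show ?thesis .
qed

end

subsection \<open>The uniform bound\<close>

text \<open>For \<open>P = 0\<close> the last summand is \<open>0\<close>, by the convention on division by zero.\<close>

lemma two_pole_bound:
  fixes P E q :: real
  assumes "P \<ge> 0" "E \<ge> 0" "q > 0" "P = 0 \<or> 2 * q\<^sup>2 \<le> P\<^sup>2"
  shows "q / ((P - E)\<^sup>2 + q\<^sup>2) + q / ((P + E)\<^sup>2 + q\<^sup>2)
    \<le> 4 * P\<^sup>2 / (q * (q\<^sup>2 + 4 * P\<^sup>2)) + 2 * q / (q\<^sup>2 + 4 * P\<^sup>2) + q\<^sup>2 / P ^ 3"
proof -
  have le: "q / (u\<^sup>2 + q\<^sup>2) \<le> 1 / q" for u
  proof -
    have "q / (u\<^sup>2 + q\<^sup>2) \<le> q / q\<^sup>2"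
      using assms(3) by (intro divide_left_mono) (auto intro!: mult_pos_pos add_nonneg_pos)
    then show ?thesis using assms(3) by (simp add: power2_eq_square)
  qed
  \<comment> \<open>The main terms are the value at resonance \<open>E = P\<close>:
    \<open>1 / q\<close> from the near pole and the other summand from the far pole at distance
    \<open>2 * P\<close>.\<close>
  have split: "4 * P\<^sup>2 / (q * (q\<^sup>2 + 4 * P\<^sup>2)) + 2 * q / (q\<^sup>2 + 4 * P\<^sup>2) = 1 / q + q / (q\<^sup>2 + 4 * P\<^sup>2)"
  proof -
    have "q\<^sup>2 + 4 * P\<^sup>2 > 0" using assms(3) by (simp add: add_pos_nonneg)
    then show ?thesis using assms(3) by (simp add: divide_simps) (simp add: algebra_simps power2_eq_square)
  qed
  show ?thesis
  proof (cases "P = 0 \<or> P \<le> E")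
    case True
    \<comment> \<open>At or beyond resonance the far pole is at distance at least
      \<open>2 * P\<close>, so neither summand exceeds its resonant value.\<close>
    have "q / ((P + E)\<^sup>2 + q\<^sup>2) \<le> q / (q\<^sup>2 + 4 * P\<^sup>2)"
    proof (rule divide_left_mono)
      have "2 * P \<le> P + E" using True assms(2) by auto
      then have "(2 * P)\<^sup>2 \<le> (P + E)\<^sup>2" using assms(1) by (intro power_mono) auto
      then show "q\<^sup>2 + 4 * P\<^sup>2 \<le> (P + E)\<^sup>2 + q\<^sup>2" by (simp add: power_mult_distrib)
      show "0 < ((P + E)\<^sup>2 + q\<^sup>2) * (q\<^sup>2 + 4 * P\<^sup>2)" using assms(3)
        by (intro mult_pos_pos add_pos_nonneg add_nonneg_pos) auto
    qed (use assms in auto)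
    moreover have "q\<^sup>2 / P ^ 3 \<ge> 0" using assms(1) by simp
    ultimately show ?thesis using le[of "P - E"] split by linarith
  next
    case False
    then have P: "P > 0" and E: "E < P" and q: "2 * q\<^sup>2 \<le> P\<^sup>2" using assms by auto
    define r where "r = P - E"
    have r: "0 < r" "r \<le> P" using E assms(2) by (auto simp: r_def)
    have pos: "(P + E)\<^sup>2 + q\<^sup>2 > 0" "q\<^sup>2 + 4 * P\<^sup>2 > 0" using assms(3)
      by (auto intro: add_nonneg_pos add_pos_nonneg)
    \<comment> \<open>Below resonance the far pole contributes more than its resonant value; the
      numerator is the factored difference of the squares of \<open>2 * P\<close> and
      \<open>P + E\<close>.\<close>
    have "q / ((P + E)\<^sup>2 + q\<^sup>2) - q / (q\<^sup>2 + 4 * P\<^sup>2)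
       = q * (r * (3 * P + E)) / (((P + E)\<^sup>2 + q\<^sup>2) * (q\<^sup>2 + 4 * P\<^sup>2))"
      using pos by (simp add: divide_simps r_def) (simp add: algebra_simps power2_eq_square)
    also have "\<dots> \<le> q * (r * (4 * P)) / (P\<^sup>2 * (4 * P\<^sup>2))"
    proof (intro frac_le mult_mono mult_left_mono)
      have "P\<^sup>2 \<le> (P + E)\<^sup>2" using P assms(2) by (intro power_mono) auto
      then show "P\<^sup>2 \<le> (P + E)\<^sup>2 + q\<^sup>2" using zero_le_power2[of q] by linarith
    qed (use P E r assms in auto)
    also have "\<dots> = q * r / P ^ 3" using P by (simp add: field_simps power2_eq_square power3_eq_cube)
    finally have 1: "q / ((P + E)\<^sup>2 + q\<^sup>2) - q / (q\<^sup>2 + 4 * P\<^sup>2) \<le> q * r / P ^ 3" .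
    \<comment> \<open>The far gain competes with the near loss. For \<open>r \<le> q\<close> the
      gain is at most the error term. For larger \<open>r\<close> the near summand is at most
      \<open>1 / (2 * q)\<close>, and the smallness of \<open>q\<close> relative to \<open>P\<close>
      bounds the gain by the same amount.\<close>
    have 2: "q / (r\<^sup>2 + q\<^sup>2) + q * r / P ^ 3 \<le> 1 / q + q\<^sup>2 / P ^ 3"
    proof (cases "r \<le> q")
      case True
      then have "q * r / P ^ 3 \<le> q\<^sup>2 / P ^ 3"
        using P assms(3) by (intro divide_right_mono) (auto simp: power2_eq_square)
      then show ?thesis using le[of r] by linarith
    next
      case False
      then have "q\<^sup>2 \<le> r\<^sup>2" using assms(3) by (intro power_mono) auto
      then have "q / (r\<^sup>2 + q\<^sup>2) \<le> q / (q\<^sup>2 + q\<^sup>2)" using assms(3) by (intro divide_left_mono) (auto intro!: mult_pos_pos add_nonneg_pos)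
      also have "\<dots> = 1 / (2 * q)" using assms(3) by (simp add: field_simps power2_eq_square)
      finally have A: "q / (r\<^sup>2 + q\<^sup>2) \<le> 1 / (2 * q)" .
      have "q * r / P ^ 3 \<le> q * P / P ^ 3" using r P assms(3) by (intro divide_right_mono mult_left_mono) auto
      also have "\<dots> = q / P\<^sup>2" using P by (simp add: field_simps power2_eq_square power3_eq_cube)
      also have "\<dots> \<le> q / (2 * q\<^sup>2)" using q assms(3) P by (intro divide_left_mono) auto
      also have "\<dots> = 1 / (2 * q)" using assms(3) by (simp add: field_simps power2_eq_square)
      finally have B: "q * r / P ^ 3 \<le> 1 / (2 * q)" .
      have "q\<^sup>2 / P ^ 3 \<ge> 0" using P by simp
      moreover have "1 / (2 * q) + 1 / (2 * q) = 1 / q" using assms(3) by (simp add: field_simps)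
      ultimately show ?thesis using A B by linarith
    qed
    show ?thesis using 1 2 split unfolding r_def by linarith
  qed
qed

text \<open>Both imaginary parts have the sign of \<open>- q\<close>, so their absolute values add.
  The pair of squared distances is invariant under changing the sign of \<open>p\<close> or of
  \<open>e\<close>, which allows passing to absolute values.\<close>

lemma Im_inverse_pair:
  fixes p q e :: real
  assumes "q \<noteq> 0"
  shows "\<bar>Im (1 / (Complex p q - of_real e) + 1 / (Complex p q + of_real e))\<bar>
    = \<bar>q\<bar> / ((\<bar>p\<bar> - \<bar>e\<bar>)\<^sup>2 + \<bar>q\<bar>\<^sup>2) + \<bar>q\<bar> / ((\<bar>p\<bar> + \<bar>e\<bar>)\<^sup>2 + \<bar>q\<bar>\<^sup>2)"
proof -
  have "Im (1 / (Complex p q - of_real e) + 1 / (Complex p q + of_real e))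
      = - (q * (1 / ((p - e)\<^sup>2 + q\<^sup>2) + 1 / ((p + e)\<^sup>2 + q\<^sup>2)))"
    by (simp add: Im_divide algebra_simps)
  also have "\<bar>\<dots>\<bar> = \<bar>q\<bar> * (1 / ((p - e)\<^sup>2 + q\<^sup>2) + 1 / ((p + e)\<^sup>2 + q\<^sup>2))"
    by (simp add: abs_mult del: minus_add_distrib) 
  also have "\<dots> = \<bar>q\<bar> * (1 / ((\<bar>p\<bar> - \<bar>e\<bar>)\<^sup>2 + q\<^sup>2) + 1 / ((\<bar>p\<bar> + \<bar>e\<bar>)\<^sup>2 + q\<^sup>2))"
    by (cases "p \<ge> 0"; cases "e \<ge> 0") (simp_all add: power2_eq_square algebra_simps)
  finally show ?thesis by (simp add: algebra_simps)
qed

lemma (in elliptic_boundary) abs_Im_trace_polarization_tensor: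
  assumes "q \<noteq> 0"
  shows "\<bar>Im (trace (polarization_tensor (Complex p q) D \<gamma>))\<bar>
    = pi * a * b * (\<bar>q\<bar> / ((\<bar>p\<bar> - \<bar>ratio / 2\<bar>)\<^sup>2 + \<bar>q\<bar>\<^sup>2) + \<bar>q\<bar> / ((\<bar>p\<bar> + \<bar>ratio / 2\<bar>)\<^sup>2 + \<bar>q\<bar>\<^sup>2))"
proof -
  have "Complex p q \<noteq> of_real r" for r using assms by (simp add: complex_eq_iff)
  from this[of "ratio / 2"] this[of "- ratio / 2"] this[of "1 / 2"]
  have "trace (polarization_tensor (Complex p q) D \<gamma>)
      = of_real (pi * a * b) * (1 / (Complex p q - of_real (ratio / 2)) + 1 / (Complex p q + of_real (ratio / 2)))"
    by (subst trace_polarization_tensor_ellipse) simp_all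
  then have "Im (trace (polarization_tensor (Complex p q) D \<gamma>))
      = pi * a * b * Im (1 / (Complex p q - of_real (ratio / 2)) + 1 / (Complex p q + of_real (ratio / 2)))"
    by simp
  then show ?thesis
    unfolding Im_inverse_pair[OF assms, symmetric] using a b by (simp add: abs_mult)
qed

text \<open>The error function \<open>g\<close> is chosen before the ellipse, so the estimate is
  uniform over all ellipses of area \<open>A\<close>, whatever their centre, angle and eccentricity;
  it may depend on \<open>lr\<close> and \<open>A\<close>.\<close>

theorem corollary4p2:
  fixes lr A :: real
  assumes "\<bar>lr\<bar> < 1/2"
  shows "\<exists>g. g \<in> O[at 0](\<lambda>li::real. li\<^sup>2 / (4 * lr\<^sup>2 + li\<^sup>2)) \<and>
    (\<forall>\<^sub>F li in at 0. \<forall>c \<theta> a b. a > 0 \<and> b > 0 \<and> measure lebesgue (ellipse c \<theta> a b) = A \<longrightarrow>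
       \<bar>Im (trace (polarization_tensor (Complex lr li) (ellipse c \<theta> a b) (ellipse_path c \<theta> a b)))\<bar>
       \<le> 4 * lr\<^sup>2 * measure lebesgue (ellipse c \<theta> a b) / (\<bar>li\<bar> * (li\<^sup>2 + 4 * lr\<^sup>2))
         + 2 * \<bar>li\<bar> * measure lebesgue (ellipse c \<theta> a b) / (li\<^sup>2 + 4 * lr\<^sup>2)
         + (g li :: real))"
proof (intro exI conjI)
  \<comment> \<open>For \<open>lr = 0\<close> division by zero makes this function \<open>0\<close>, which is then the right error term.\<close>
  let ?g = "\<lambda>li. A * (li\<^sup>2 / \<bar>lr\<bar> ^ 3)"
  show "?g \<in> O[at 0](\<lambda>li::real. li\<^sup>2 / (4 * lr\<^sup>2 + li\<^sup>2))"
  proof (cases "lr = 0")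
    case False
    \<comment> \<open>For |li| < 1 the denominator of the comparison function is at most
      \<open>4 * lr\<^sup>2 + 1\<close>, which supplies this factor of the constant.\<close>
    have "\<forall>\<^sub>F li in at (0::real). norm (?g li) \<le> \<bar>A\<bar> / \<bar>lr\<bar> ^ 3 * (4 * lr\<^sup>2 + 1) * norm (li\<^sup>2 / (4 * lr\<^sup>2 + li\<^sup>2))"
      unfolding eventually_at
    proof (intro exI[of _ 1] conjI ballI impI)
      fix li :: real assume "li \<noteq> 0 \<and> dist li 0 < 1"
      then have "li\<^sup>2 \<le> 1" by (simp add: abs_square_le_1)
      moreover have pos: "4 * lr\<^sup>2 + li\<^sup>2 > 0" using False by (simp add: add_pos_nonneg)
      ultimately have "li\<^sup>2 * 1 \<le> li\<^sup>2 * ((4 * lr\<^sup>2 + 1) / (4 * lr\<^sup>2 + li\<^sup>2))"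
        by (intro mult_left_mono) auto
      then have "\<bar>A\<bar> / \<bar>lr\<bar> ^ 3 * li\<^sup>2 \<le> \<bar>A\<bar> / \<bar>lr\<bar> ^ 3 * (li\<^sup>2 * ((4 * lr\<^sup>2 + 1) / (4 * lr\<^sup>2 + li\<^sup>2)))"
        by (intro mult_left_mono) auto
      then show "norm (?g li) \<le> \<bar>A\<bar> / \<bar>lr\<bar> ^ 3 * (4 * lr\<^sup>2 + 1) * norm (li\<^sup>2 / (4 * lr\<^sup>2 + li\<^sup>2))"
        using pos by (simp add: abs_mult mult_ac)
    qed simp
    then show ?thesis by (rule bigoI)
  qed simp
  \<comment> \<open>The smallness premise of \<open>two_pole_bound\<close>; the threshold depends on
    \<open>lr\<close> alone and not on the ellipse.\<close>
  have small: "\<forall>\<^sub>F li in at (0::real). lr = 0 \<or> 2 * li\<^sup>2 \<le> lr\<^sup>2"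
  proof (cases "lr = 0")
    case False
    have "((\<lambda>li::real. 2 * li\<^sup>2) \<longlongrightarrow> 0) (at 0)" by (auto intro!: tendsto_eq_intros)
    then have "\<forall>\<^sub>F li in at (0::real). 2 * li\<^sup>2 < lr\<^sup>2" by (rule order_tendstoD(2)) (use False in simp)
    then show ?thesis by eventually_elim simp
  qed simp
  have "\<forall>\<^sub>F li in at (0::real). li \<noteq> 0" by (simp add: eventually_at_filter)
  with small show "\<forall>\<^sub>F li in at 0. \<forall>c \<theta> a b. a > 0 \<and> b > 0 \<and> measure lebesgue (ellipse c \<theta> a b) = A \<longrightarrow>
       \<bar>Im (trace (polarization_tensor (Complex lr li) (ellipse c \<theta> a b) (ellipse_path c \<theta> a b)))\<bar>
       \<le> 4 * lr\<^sup>2 * measure lebesgue (ellipse c \<theta> a b) / (\<bar>li\<bar> * (li\<^sup>2 + 4 * lr\<^sup>2))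
         + 2 * \<bar>li\<bar> * measure lebesgue (ellipse c \<theta> a b) / (li\<^sup>2 + 4 * lr\<^sup>2) + ?g li"
  proof eventually_elim
    case (elim li)
    show ?case
    proof (intro allI impI)
      fix c :: "real^2" and \<theta> a b :: real
      assume *: "a > 0 \<and> b > 0 \<and> measure lebesgue (ellipse c \<theta> a b) = A"
      then interpret elliptic_boundary c \<theta> a b by unfold_locales auto
      have A: "A = pi * a * b" using * measure_ellipse by simp
      have "\<bar>Im (trace (polarization_tensor (Complex lr li) D \<gamma>))\<bar>
          \<le> A * (4 * \<bar>lr\<bar>\<^sup>2 / (\<bar>li\<bar> * (\<bar>li\<bar>\<^sup>2 + 4 * \<bar>lr\<bar>\<^sup>2)) + 2 * \<bar>li\<bar> / (\<bar>li\<bar>\<^sup>2 + 4 * \<bar>lr\<bar>\<^sup>2) + \<bar>li\<bar>\<^sup>2 / \<bar>lr\<bar> ^ 3)"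
        unfolding abs_Im_trace_polarization_tensor[OF elim(2)] A using a b elim
        by (intro mult_left_mono two_pole_bound) auto
      then show "\<bar>Im (trace (polarization_tensor (Complex lr li) D \<gamma>))\<bar>
       \<le> 4 * lr\<^sup>2 * measure lebesgue D / (\<bar>li\<bar> * (li\<^sup>2 + 4 * lr\<^sup>2))
         + 2 * \<bar>li\<bar> * measure lebesgue D / (li\<^sup>2 + 4 * lr\<^sup>2) + ?g li"
        using * by (simp add: distrib_left mult_ac)
    qed
  qed
qed

end
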